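(* $\mathsf{P}\subseteq\mathsf{pc\text{-}strong\text{-}low\text{-}CDEB}(\mathsf{con\text{-}space},\infty\text{-}\mathsf{time},\mathsf{con\text{-}coin})$. That is, for every alphabet $\Sigma$, every language $L\subseteq\Sigma^*$ in $\mathsf{P}$ and every real $\varepsilon>0$, there is a complete-information debate system verifier $V$ (a finite-state verifier, with a finite prover alphabet $\Gamma_1$ and a disjoint finite refuter alphabet $\Gamma_0$) and a constant $c$ (both $V$ and $c$ may depend on $L$ and $\varepsilon$) such that $V$ tosses at most $c$ coins on every input, for every pair of player strategies, and for every sequence of coin outcomes, and such that \[ \forall w\in L\;\exists P\;\forall R:\ \operatorname{acc}_{V,P,R}(w)=1, \] \[ \forall w\in\Sigma^*\setminus L\;\forall P\;\exists R:\ \operatorname{rej}_{V,P,R}(w)\ge 1-\varepsilon, \] where $P$ ranges over all prover strategies and $R$ over all refuter strategies.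
   Context: $\mathsf{P}$ is the class of languages decidable in deterministic polynomial time. An alphabet $\Sigma$ is a finite nonempty set of symbols; $\triangleright,\triangleleft\notin\Sigma$ are distinct endmarkers. Complete-information debate system (CDS). There are three agents: a probabilistic verifier $V$, a prover $P$ and a refuter $R$. The verifier has finite-state memory (no work tape; this realizes the constant-space restriction), a single two-way head on a read-only input tape containing $\triangleright w\triangleleft$, where $w\in\Sigma^*$ is the input, and a single one-way head on a read-only debate tape. In a step the two-way head may move one cell left or right or stay in place; the one-way head may move one cell right or stay in place. The input head initially scans $\triangleright$ and the debate head initially scans the first debate symbol. The verifier's behavior is determined by its current state, the scanned input symbol, the scanned debate symbol, and the outcomes of independent fair coin tosses, which it may make at steps of its choosing (not every step need toss a coin). It may halt and accept, halt and reject, or run forever. $\Gamma_1$ and $\Gamma_0$ are disjoint finite alphabets of prover and refuter messages, and $\Gamma=\Gamma_1\cup\Gamma_0$. Strategies are arbitrary functions $P:\Sigma^*\times\Gamma^*\to\Gamma_1$ and $R:\Sigma^*\times\Gamma^*\to\Gamma_0$ (computationally unbounded; used on debate prefixes of even and odd length, respectively). On input $w$ they determine the infinite debate string $\gamma_1\gamma_2\cdots$ by $\gamma_j=P(w,\gamma_1\cdots\gamma_{j-1})$ for odd $j$ and $\gamma_j=R(w,\gamma_1\cdots\gamma_{j-1})$ for even $j$. The debate tape contains this string. The verifier's coins are private: the strategies do not depend on them. $\operatorname{acc}_{V,P,R}(w)$ and $\operatorname{rej}_{V,P,R}(w)$ are the probabilities, over the verifier's private coins, that $V$ halts and accepts,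 respectively halts and rejects, on input $w$ with players $P,R$; the remaining probability is that of nontermination. $\mathsf{pc\text{-}strong\text{-}low\text{-}CDEB}(\mathsf{con\text{-}space},\infty\text{-}\mathsf{time},\mathsf{con\text{-}coin})$ is the class of languages $L$ for which, for every $\varepsilon>0$, there is a CDS verifier $V$ satisfying the two displayed conditions in the claim (perfect completeness and strong error at most $\varepsilon$) that uses at most a constant amount of space (finite-state memory) and tosses at most a constant number of coins; these bounds may depend on $L$ and $\varepsilon$ but hold for every input, every pair of player strategies and every sequence of coin outcomes. No time bound is imposed on the verifier. *)

theory Defs
  imports "HOL-Probability.Probability" "HOL-Computational_Algebra.Polynomial"
begin

datatype dir = MoveL | Stay | MoveR

primrec move :: "dir \<Rightarrow> 'b \<Rightarrow> 'b::{plus, minus, one}" where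
  "move MoveL p = p - 1"
| "move Stay p = p"
| "move MoveR p = p + 1"


text \<open>
  Deterministic Turing machines with a single two-way infinite tape. States and auxiliary tape
  symbols are natural numbers, so that ``there is a machine'' does not quantify over types.
\<close>

datatype 'a tape_symbol = Blank | Input 'a | Aux nat

record 'a tm =
  tm_states :: "nat set"
  tm_symbols :: "'a tape_symbol set"
  tm_start :: nat
  tm_accept :: nat
  tm_reject :: nat
  tm_delta :: "nat \<Rightarrow> 'a tape_symbol \<Rightarrow> nat \<times> 'a tape_symbol \<times> dir"

definition wf_tm :: "'a set \<Rightarrow> 'a tm \<Rightarrow> bool" where
  "wf_tm \<Sigma> M \<longleftrightarrow>
     finite (tm_states M) \<and> finite (tm_symbols M) \<and>
     insert Blank (Input ` \<Sigma>) \<subseteq> tm_symbols M \<and>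
     {tm_start M, tm_accept M, tm_reject M} \<subseteq> tm_states M \<and> tm_accept M \<noteq> tm_reject M \<and>
     (\<forall>q \<in> tm_states M - {tm_accept M, tm_reject M}. \<forall>a \<in> tm_symbols M.
        tm_delta M q a \<in> tm_states M \<times> tm_symbols M \<times> UNIV)"

text \<open>A configuration consists of the state, the tape contents and the head position.\<close>

type_synonym 'a tm_config = "nat \<times> (int \<Rightarrow> 'a tape_symbol) \<times> int"

definition tm_init :: "'a tm \<Rightarrow> 'a list \<Rightarrow> 'a tm_config" where
  "tm_init M w =
     (tm_start M,
      (\<lambda>p. if 0 \<le> p \<and> p < int (length w) then Input (w ! nat p) else Blank),
      0)"

fun tm_step :: "'a tm \<Rightarrow> 'a tm_config \<Rightarrow> 'a tm_config" where
  "tm_step M (q, tape, p) =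
     (if q \<in> {tm_accept M, tm_reject M} then (q, tape, p)
      else let (q', a, m) = tm_delta M q (tape p) in (q', tape(p := a), move m p))"

definition class_P :: "'a set \<Rightarrow> 'a list set set" where
  "class_P \<Sigma> = {L. L \<subseteq> lists \<Sigma> \<and>
     (\<exists>(M :: 'a tm) (p :: nat poly). wf_tm \<Sigma> M \<and>
        (\<forall>w \<in> lists \<Sigma>. \<exists>t \<le> poly p (length w).
           fst ((tm_step M ^^ t) (tm_init M w)) =
             (if w \<in> L then tm_accept M else tm_reject M)))}"


datatype 'a input_symbol = LeftEnd | Sym 'a | RightEnd

text \<open>
  A transition gives the next state, the move of the input head, and whether the debate head
  advances by one cell. At each step the verifier either moves deterministically or tosses one
  fair coin that selects between two transitions.
\<close>

type_synonym transition = "nat \<times> dir \<times> bool"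

datatype action = Det transition | Toss transition transition

primrec transitions :: "action \<Rightarrow> transition set" where
  "transitions (Det \<tau>) = {\<tau>}"
| "transitions (Toss \<tau> \<tau>') = {\<tau>, \<tau>'}"

record 'a verifier =
  states :: "nat set"
  prover_symbols :: "nat set"
  refuter_symbols :: "nat set"
  start :: nat
  accept :: nat
  reject :: nat
  delta :: "nat \<Rightarrow> 'a input_symbol \<Rightarrow> nat \<Rightarrow> action"

abbreviation debate_symbols :: "'a verifier \<Rightarrow> nat set" where
  "debate_symbols V \<equiv> prover_symbols V \<union> refuter_symbols V"

text \<open>The conditions on \<open>m\<close> keep the input head between the endmarkers.\<close>

definition wf_verifier :: "'a set \<Rightarrow> 'a verifier \<Rightarrow> bool" where
  "wf_verifier \<Sigma> V \<longleftrightarrow>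
     finite (states V) \<and>
     finite (prover_symbols V) \<and> prover_symbols V \<noteq> {} \<and>
     finite (refuter_symbols V) \<and> refuter_symbols V \<noteq> {} \<and>
     prover_symbols V \<inter> refuter_symbols V = {} \<and>
     {start V, accept V, reject V} \<subseteq> states V \<and> accept V \<noteq> reject V \<and>
     (\<forall>q \<in> states V - {accept V, reject V}. \<forall>x \<in> {LeftEnd, RightEnd} \<union> Sym ` \<Sigma>.
        \<forall>g \<in> debate_symbols V. \<forall>(q', m, adv) \<in> transitions (delta V q x g).
          q' \<in> states V \<and>
          (x = LeftEnd \<longrightarrow> m \<noteq> MoveL) \<and> (x = RightEnd \<longrightarrow> m \<noteq> MoveR))"

type_synonym 'a strategy = "'a list \<Rightarrow> nat list \<Rightarrow> nat"

definition prover_strategies :: "'a set \<Rightarrow> 'a verifier \<Rightarrow> 'a strategy set" where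
  "prover_strategies \<Sigma> V = lists \<Sigma> \<rightarrow> lists (debate_symbols V) \<rightarrow> prover_symbols V"

definition refuter_strategies :: "'a set \<Rightarrow> 'a verifier \<Rightarrow> 'a strategy set" where
  "refuter_strategies \<Sigma> V = lists \<Sigma> \<rightarrow> lists (debate_symbols V) \<rightarrow> refuter_symbols V"

text \<open>
  The debate string is indexed from 0, so the prover supplies the symbols at even indices: the
  symbol at index \<open>n\<close> is chosen on a prefix of length \<open>n\<close>.
\<close>

primrec debate_prefix :: "'a strategy \<Rightarrow> 'a strategy \<Rightarrow> 'a list \<Rightarrow> nat \<Rightarrow> nat list" where
  "debate_prefix P R w 0 = []"
| "debate_prefix P R w (Suc n) = debate_prefix P R w n @
     [(if even n then P else R) w (debate_prefix P R w n)]"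

definition debate :: "'a strategy \<Rightarrow> 'a strategy \<Rightarrow> 'a list \<Rightarrow> nat \<Rightarrow> nat" where
  "debate P R w n = (if even n then P else R) w (debate_prefix P R w n)"

text \<open>
  A configuration consists of the state, the two head positions and the number of coins tossed
  so far; the coin tosses read the sequence \<open>\<omega>\<close> from left to right. Halting configurations are
  fixed points of the step function.
\<close>

type_synonym config = "nat \<times> nat \<times> nat \<times> nat"

fun apply_transition :: "transition \<Rightarrow> nat \<Rightarrow> nat \<Rightarrow> nat \<Rightarrow> config" where
  "apply_transition (q', m, adv) i j k = (q', move m i, if adv then j + 1 else j, k)"

definition input_tape :: "'a list \<Rightarrow> 'a input_symbol list" where
  "input_tape w = LeftEnd # map Sym w @ [RightEnd]"

fun verifier_step ::
    "'a verifier \<Rightarrow> 'a list \<Rightarrow> (nat \<Rightarrow> nat) \<Rightarrow> (nat \<Rightarrow> bool) \<Rightarrow> config \<Rightarrow> config" where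
  "verifier_step V w d \<omega> (q, i, j, k) =
     (if q \<in> {accept V, reject V} then (q, i, j, k)
      else case delta V q (input_tape w ! i) (d j) of
             Det \<tau> \<Rightarrow> apply_transition \<tau> i j k
           | Toss \<tau> \<tau>' \<Rightarrow> apply_transition (if \<omega> k then \<tau> else \<tau>') i j (k + 1))"

definition verifier_run ::
    "'a verifier \<Rightarrow> 'a strategy \<Rightarrow> 'a strategy \<Rightarrow> 'a list \<Rightarrow> (nat \<Rightarrow> bool) \<Rightarrow> nat \<Rightarrow> config" where
  "verifier_run V P R w \<omega> t = (verifier_step V w (debate P R w) \<omega> ^^ t) (start V, 0, 0, 0)"

definition config_state :: "config \<Rightarrow> nat" where
  "config_state = (\<lambda>(q, i, j, k). q)"

definition coins_tossed :: "config \<Rightarrow> nat" where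
  "coins_tossed = (\<lambda>(q, i, j, k). k)"

definition fair_coins :: "(nat \<Rightarrow> bool) measure" where
  "fair_coins = (\<Pi>\<^sub>M n \<in> UNIV. measure_pmf (bernoulli_pmf (1 / 2)))"

definition acc_prob ::
    "'a verifier \<Rightarrow> 'a strategy \<Rightarrow> 'a strategy \<Rightarrow> 'a list \<Rightarrow> real" where
  "acc_prob V P R w =
     measure fair_coins {\<omega>. \<exists>t. config_state (verifier_run V P R w \<omega> t) = accept V}"

definition rej_prob ::
    "'a verifier \<Rightarrow> 'a strategy \<Rightarrow> 'a strategy \<Rightarrow> 'a list \<Rightarrow> real" where
  "rej_prob V P R w =
     measure fair_coins {\<omega>. \<exists>t. config_state (verifier_run V P R w \<omega> t) = reject V}"

definition tosses_at_most :: "'a set \<Rightarrow> 'a verifier \<Rightarrow> nat \<Rightarrow> bool" where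
  "tosses_at_most \<Sigma> V c \<longleftrightarrow>
     (\<forall>w \<in> lists \<Sigma>. \<forall>P \<in> prover_strategies \<Sigma> V. \<forall>R \<in> refuter_strategies \<Sigma> V. \<forall>\<omega> t.
        coins_tossed (verifier_run V P R w \<omega> t) \<le> c)"

text \<open>
  The constant space bound is the finiteness of the state set in \<^const>\<open>wf_verifier\<close>; no
  time bound is imposed.
\<close>

definition pc_strong_low_CDEB_con_inf_con :: "'a set \<Rightarrow> 'a list set set" where
  "pc_strong_low_CDEB_con_inf_con \<Sigma> = {L. L \<subseteq> lists \<Sigma> \<and>
     (\<forall>\<epsilon>::real. \<epsilon> > 0 \<longrightarrow>
       (\<exists>(V :: 'a verifier) (c :: nat). wf_verifier \<Sigma> V \<and> tosses_at_most \<Sigma> V c \<and>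
          (\<forall>w \<in> L. \<exists>P \<in> prover_strategies \<Sigma> V. \<forall>R \<in> refuter_strategies \<Sigma> V.
             acc_prob V P R w = 1) \<and>
          (\<forall>w \<in> lists \<Sigma> - L. \<forall>P \<in> prover_strategies \<Sigma> V. \<exists>R \<in> refuter_strategies \<Sigma> V.
             rej_prob V P R w \<ge> 1 - \<epsilon>)))}"

end

theory Submission imports Defs begin

text \<open>
  The players debate over a run of the Turing machine. Going forward, the prover announces the
  symbol scanned at each step. As soon as an announcement is false the refuter challenges it,
  and the debate turns backwards: a claim "cell \<open>p\<close> at time \<open>t + 1\<close> contains \<open>c\<close>" is supported
  by three claims about the neighbours of \<open>p\<close> at time \<open>t\<close>, of which the refuter chosen_heads a false one,
  until at time \<open>0\<close> the claim is compared with the input. The counters \<open>t\<close> and \<open>p\<close> are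
  polynomially bounded, so their digits in base \<open>length w + 2\<close> are the positions of a constant
  number of imaginary heads on the input tape. The verifier has only one head, but the prover also
  announces what every imaginary head scans, and the verifier privately tracks a single random one
  and rejects at once if its symbol is announced wrongly.

  A lying prover could make the untracked branches run forever. Therefore the refuter may at any
  time voice a doubt, which ends the round: the simulation restarts from scratch, with a fresh
  random head. In every round a lie is caught with probability at least \<open>2 ^ -K\<close>, where
  \<open>K\<close> is the number of heads, and after a constant number \<open>N\<close> of doubted rounds the verifier
  accepts, so unfounded doubts do no harm.
\<close>

section \<open>Digits, powers and fair coins\<close>

text \<open>In the model verifier states and debate symbols are natural numbers, whereas the
  construction works with structured values; an arbitrary injective numbering of a finite set
  mediates.\<close>

definition code :: "'x set \<Rightarrow> 'x \<Rightarrow> nat" where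
  "code A = (SOME f. inj_on f A)"

definition decode :: "'x set \<Rightarrow> nat \<Rightarrow> 'x" where
  "decode A = inv_into A (code A)"

lemma inj_on_code:
  assumes "finite A"
  shows "inj_on (code A) A"
proof -
  have "\<exists>f :: 'a \<Rightarrow> nat. inj_on f A"
    using finite_imp_inj_to_nat_seg[OF assms] by blast
  then show ?thesis
    unfolding code_def by (rule someI_ex)
qed

lemma decode_code:
  assumes "finite A" "x \<in> A"
  shows "decode A (code A x) = x"
  unfolding decode_def using inj_on_code[OF assms(1)] assms(2) by (rule inv_into_f_f)

section \<open>Base-\<open>b\<close> digits of an integer and of its neighbours\<close>

lemma succ_div:
  fixes x b :: int
  assumes "b > 0"
  shows "(x + 1) div b = x div b + (if x mod b = b - 1 then 1 else 0)"
proof -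
  have x: "x = b * (x div b) + x mod b" by simp
  have r: "0 \<le> x mod b" "x mod b < b" using assms by auto
  show ?thesis
  proof (cases "x mod b = b - 1")
    case True
    then have "x + 1 = b * (x div b) + b" using x by linarith
    then have "x + 1 = b * (x div b + 1)" by (simp add: distrib_left)
    then show ?thesis using True assms by (metis nonzero_mult_div_cancel_left less_irrefl)
  next
    case False
    have "(x + 1) div b = (x mod b + 1 + b * (x div b)) div b" using x by (simp add: algebra_simps)
    also have "\<dots> = x div b + (x mod b + 1) div b" using assms by (subst div_mult_self2) auto
    also have "(x mod b + 1) div b = 0" using False r by (intro div_pos_pos_trivial) auto
    finally show ?thesis using False by simp
  qed
qed

lemma pred_div:
  fixes x b :: int
  assumes "b > 0"
  shows "(x - 1) div b = x div b - (if x mod b = 0 then 1 else 0)"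
proof -
  have "(x - 1) mod b = b - 1 \<longleftrightarrow> x mod b = 0"
  proof
    assume "(x - 1) mod b = b - 1"
    then have "x - 1 = b * ((x - 1) div b) + (b - 1)" using mult_div_mod_eq[of b "x - 1"] by simp
    then have "x = b * ((x - 1) div b + 1)" by (simp add: distrib_left)
    then show "x mod b = 0" by (metis mod_mult_self1_is_0)
  next
    assume "x mod b = 0"
    then obtain y where "x = b * y" by auto
    then have "x - 1 = b - 1 + b * (y - 1)" by (simp add: right_diff_distrib)
    then have "(x - 1) mod b = (b - 1) mod b" by (metis mod_mult_self2)
    also have "(b - 1) mod b = b - 1" using assms by (intro mod_pos_pos_trivial) auto
    finally show "(x - 1) mod b = b - 1" .
  qed
  then show ?thesis using succ_div[OF assms, of "x - 1"] by simp
qed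

lemma div_power_Suc:
  fixes v b :: int
  assumes "b > 0"
  shows "v div b ^ Suc j = v div b ^ j div b"
  unfolding power_Suc2 using assms by (subst zdiv_zmult2_eq) auto

text \<open>A carry reaches position \<open>j\<close> exactly when all lower digits are maximal.
  Since \<open>div\<close> rounds down, this covers negative \<open>v\<close> too, as cells to the
  left of the input require.\<close>

lemma succ_div_power:
  fixes v b :: int
  assumes "b > 0"
  shows "(v + 1) div b ^ j = v div b ^ j + (if \<forall>i<j. v div b ^ i mod b = b - 1 then 1 else 0)"
proof (induction j)
  case (Suc j)
  have "(v + 1) div b ^ Suc j = ((v + 1) div b ^ j) div b"
    using div_power_Suc[OF assms] .
  also have "\<dots> = v div b ^ j div b + (if \<forall>i<Suc j. v div b ^ i mod b = b - 1 then 1 else 0)"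
    unfolding Suc using succ_div[OF assms, of "v div b ^ j"] by (auto simp: less_Suc_eq)
  finally show ?case unfolding div_power_Suc[OF assms] .
qed simp

lemma pred_div_power:
  fixes v b :: int
  assumes "b > 0"
  shows "(v - 1) div b ^ j = v div b ^ j - (if \<forall>i<j. v div b ^ i mod b = 0 then 1 else 0)"
proof (induction j)
  case (Suc j)
  have "(v - 1) div b ^ Suc j = ((v - 1) div b ^ j) div b"
    using div_power_Suc[OF assms] .
  also have "\<dots> = v div b ^ j div b - (if \<forall>i<Suc j. v div b ^ i mod b = 0 then 1 else 0)"
    unfolding Suc using pred_div[OF assms, of "v div b ^ j"] by (auto simp: less_Suc_eq)
  finally show ?case unfolding div_power_Suc[OF assms] .
qed simp

lemma digits_zero_imp:
  fixes v b :: int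
  assumes "b > 0" "\<forall>i<j. v div b ^ i mod b = 0"
  shows "v = b ^ j * (v div b ^ j)"
  using assms(2)
proof (induction j)
  case (Suc j)
  then have "v = b ^ j * (v div b ^ j)" by simp
  also have "v div b ^ j = b * (v div b ^ j div b)"
    using Suc.prems by (metis lessI mult_div_mod_eq add.right_neutral)
  also have "v div b ^ j div b = v div b ^ Suc j"
    using div_power_Suc[OF assms(1)] by simp
  finally show ?case by (simp add: mult.assoc mult.left_commute)
qed simp

text \<open>Vanishing low digits make \<open>v\<close> a multiple of \<open>b ^ m\<close>, and the
  bound leaves only \<open>0\<close>.\<close>

lemma digits_zero_iff:
  fixes v b :: int
  assumes "b > 0" "\<bar>v\<bar> < b ^ m"
  shows "(\<forall>i<m. v div b ^ i mod b = 0) \<longleftrightarrow> v = 0"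
proof
  assume "\<forall>i<m. v div b ^ i mod b = 0"
  then have v: "v = b ^ m * (v div b ^ m)" using digits_zero_imp assms(1) by blast
  then show "v = 0"
    using assms by (metis dvd_imp_le_int dvd_triv_left not_le abs_of_pos zero_less_power)
qed simp

text \<open>If all digits but the lowest vanish, then \<open>v = b ^ m * z + v mod b\<close> for
  some \<open>z\<close>. The extra \<open>b\<close> in the bound excludes \<open>z = -1\<close>,
  where the remainder can lift \<open>v\<close> up to \<open>b - 1\<close> above
  \<open>- b ^ m\<close>.\<close>

lemma high_digits_zero_iff:
  fixes v b :: int
  assumes "b > 1" "m > 0" "\<bar>v\<bar> + b \<le> b ^ m"
  shows "(\<forall>i. 0 < i \<and> i < m \<longrightarrow> v div b ^ i mod b = 0) \<longleftrightarrow> 0 \<le> v \<and> v < b"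
proof
  assume h: "\<forall>i. 0 < i \<and> i < m \<longrightarrow> v div b ^ i mod b = 0"
  obtain m' where m: "m = Suc m'" using assms(2) by (cases m) auto
  have "\<forall>i<m'. (v div b) div b ^ i mod b = 0"
  proof (intro allI impI)
    fix i assume "i < m'"
    then have "v div b ^ Suc i mod b = 0" using h m by auto
    then show "(v div b) div b ^ i mod b = 0" using assms(1) by (simp add: zdiv_zmult2_eq)
  qed
  then have "v div b = b ^ m' * (v div b div b ^ m')" using digits_zero_imp assms(1) by simp
  then obtain z where z: "v div b = b ^ m' * z" by blast
  have v: "v = b ^ m * z + v mod b"
    using z mult_div_mod_eq[of b v] by (simp add: m mult.assoc)
  have r: "0 \<le> v mod b" "v mod b < b" using assms(1) by auto
  have bm: "0 < b ^ m" using assms(1) by simp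
  have "z = 0"
  proof (rule ccontr)
    assume "z \<noteq> 0"
    then consider "z \<ge> 1" | "z \<le> -1" by linarith
    then show False
    proof cases
      case 1
      then have "b ^ m * 1 \<le> b ^ m * z" using bm by (intro mult_left_mono) auto
      then show False using v r assms(1,3) by linarith
    next
      case 2
      then have "b ^ m * z \<le> b ^ m * -1" using bm by (intro mult_left_mono) auto
      then show False using v r assms(1,3) by linarith
    qed
  qed
  then show "0 \<le> v \<and> v < b" using v r by simp
next
  assume v: "0 \<le> v \<and> v < b"
  show "\<forall>i. 0 < i \<and> i < m \<longrightarrow> v div b ^ i mod b = 0"
  proof (intro allI impI)
    fix i assume "0 < i \<and> i < m"
    then have "b ^ 1 \<le> b ^ i" using assms(1) by (intro power_increasing) auto
    then show "v div b ^ i mod b = 0" using v by (simp add: div_pos_pos_trivial)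
  qed
qed

text \<open>A polynomial time bound thus fits into a constant number of digits in base
  \<open>n + 2\<close>. In the induction the coefficient \<open>a\<close> is absorbed by
  \<open>a < 2 ^ a\<close>, the factor \<open>n\<close> by one more power, and the factor
  \<open>2\<close> from the sum by another.\<close>

lemma poly_less_power:
  fixes p :: "nat poly"
  shows "\<exists>m. \<forall>n. poly p n < (n + 2) ^ m"
proof (induction p)
  case 0
  then show ?case by (intro exI[of _ 0]) simp
next
  case (pCons a p)
  then obtain m where m: "\<And>n. poly p n < (n + 2) ^ m" by blast
  have "poly (pCons a p) n < (n + 2) ^ (a + m + 2)" for n
  proof -
    have "a < 2 ^ a" by (rule less_exp)
    also have "\<dots> \<le> (n + 2) ^ a" by (intro power_mono) auto
    also have "\<dots> \<le> (n + 2) ^ (a + m + 1)" by (intro power_increasing) auto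
    finally have a: "a < (n + 2) ^ (a + m + 1)" .
    have "n * poly p n \<le> (n + 2) * (n + 2) ^ m" using m[of n] by (intro mult_mono) auto
    also have "\<dots> \<le> (n + 2) ^ (a + m + 1)" by (subst power_Suc[symmetric], intro power_increasing) auto
    finally have "poly (pCons a p) n < 2 * (n + 2) ^ (a + m + 1)" using a by simp
    also have "\<dots> \<le> (n + 2) ^ (a + m + 2)" by simp
    finally show ?thesis .
  qed
  then show ?case by blast
qed

text \<open>
  Each block of \<open>K\<close> coins selects a head, by the number of leading tails; every head is
  selected by some block.
\<close>

primrec chosen_heads :: "nat \<Rightarrow> nat \<Rightarrow> bool list \<Rightarrow> nat list" where
  "chosen_heads K 0 u = []"
| "chosen_heads K (Suc N) u = length (takeWhile Not (take K u)) mod K # chosen_heads K N (drop K u)"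

lemma length_chosen_heads [simp]: "length (chosen_heads K N u) = N"
  by (induction N arbitrary: u) auto

lemma set_chosen_heads: "K > 0 \<Longrightarrow> set (chosen_heads K N u) \<subseteq> {..<K}"
  by (induction N arbitrary: u) auto

lemma finite_bool_lists: "finite {u :: bool list. length u = c \<and> Q u}"
  by (rule finite_subset[OF _ finite_lists_length_eq[of UNIV c]]) auto

lemma card_bool_lists: "card {u :: bool list. length u = c} = 2 ^ c"
  using card_lists_length_eq[of "UNIV :: bool set" c] by simp

text \<open>At least one of the \<open>2 ^ K\<close> outcomes of a block selects the target of that
  block, so at most \<open>2 ^ K - 1\<close> miss it, and these bounds multiply over the
  blocks.\<close>

lemma card_chosen_heads_miss:
  assumes "K > 0" "length tgt = N" "set tgt \<subseteq> {..<K}"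
  shows "card {u. length u = N * K \<and> list_all2 (\<noteq>) (chosen_heads K N u) tgt} \<le> (2 ^ K - 1) ^ N"
  using assms(2,3)
proof (induction N arbitrary: tgt)
  case 0
  have "{u :: bool list. length u = 0 * K \<and> list_all2 (\<noteq>) (chosen_heads K 0 u) tgt} \<subseteq> {[]}" by auto
  from card_mono[OF _ this] show ?case by simp
next
  case (Suc N)
  obtain x tgt' where t: "tgt = x # tgt'" using Suc.prems(1) by (cases tgt) auto
  have x: "x < K" using Suc.prems t by auto
  \<comment> \<open>An outcome that selects \<open>x\<close>: the \<open>x\<close> leading
    \<open>False\<close> entries are followed by a \<open>True\<close> because
    \<open>x < K\<close>.\<close>
  define b where "b = replicate x False @ replicate (K - x) True"
  have lb: "length b = K" using x by (simp add: b_def)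
  have tw: "length (takeWhile Not b) = x"
    unfolding b_def using x by (cases "K - x") (auto simp: takeWhile_append)
  define A where "A = {u. length u = Suc N * K \<and> list_all2 (\<noteq>) (chosen_heads K (Suc N) u) tgt}"
  define B where "B = {u. length u = N * K \<and> list_all2 (\<noteq>) (chosen_heads K N u) tgt'}"
  define C where "C = {u :: bool list. length u = K} - {b}"
  have "inj_on (\<lambda>u. (take K u, drop K u)) A"
    by (rule inj_onI) (metis append_take_drop_id prod.inject)
  moreover have "(\<lambda>u. (take K u, drop K u)) ` A \<subseteq> C \<times> B"
  proof clarify
    fix u assume u: "u \<in> A"
    have "take K u \<noteq> b"
    proof
      assume "take K u = b"
      then show False using u t tw x by (auto simp: A_def)
    qed
    then show "take K u \<in> C \<and> drop K u \<in> B"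
      using u t by (auto simp: A_def B_def C_def)
  qed
  moreover have "finite (C \<times> B)"
    using finite_bool_lists[of K "\<lambda>_. True"] finite_bool_lists by (auto simp: B_def C_def)
  ultimately have "card A \<le> card (C \<times> B)" by (rule card_inj_on_le)
  also have "\<dots> = (2 ^ K - 1) * card B"
    using lb by (simp add: card_cartesian_product C_def card_Diff_singleton card_bool_lists)
  also have "\<dots> \<le> (2 ^ K - 1) * (2 ^ K - 1) ^ N"
    using Suc.IH[of tgt'] Suc.prems t by (intro mult_left_mono) (auto simp: B_def)
  finally show ?case by (simp add: A_def)
qed

section \<open>Events determined by finitely many coins\<close>

lemma prob_space_fair_coins: "prob_space fair_coins"
  unfolding fair_coins_def by (intro prob_space_PiM measure_pmf.prob_space_axioms)

lemma space_fair_coins [simp]: "space fair_coins = UNIV"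
  by (simp add: fair_coins_def space_PiM)

lemma fair_coins_cylinder:
  assumes "length u = c"
  shows "{\<omega>. map \<omega> [0..<c] = u} \<in> sets fair_coins"
    and "measure fair_coins {\<omega>. map \<omega> [0..<c] = u} = 1 / 2 ^ c"
proof -
  interpret product_prob_space "\<lambda>n::nat. measure_pmf (bernoulli_pmf (1/2))" UNIV
    by unfold_locales
  have e: "{\<omega>. map \<omega> [0..<c] = u} =
      prod_emb UNIV (\<lambda>n. measure_pmf (bernoulli_pmf (1/2))) {..<c} (\<Pi>\<^sub>E i\<in>{..<c}. {u ! i})"
  proof -
    have "map \<omega> [0..<c] = u \<longleftrightarrow> (\<forall>i<c. \<omega> i = u ! i)" for \<omega>
      using assms by (auto simp: list_eq_iff_nth_eq)
    then have "{\<omega>. map \<omega> [0..<c] = u} = {\<omega>. \<forall>i<c. \<omega> i = u ! i}" by simp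
    also have "\<dots> = prod_emb UNIV (\<lambda>n. measure_pmf (bernoulli_pmf (1/2))) {..<c} (\<Pi>\<^sub>E i\<in>{..<c}. {u ! i})"
    proof (rule set_eqI)
      fix \<omega> :: "nat \<Rightarrow> bool"
      have "restrict \<omega> {..<c} \<in> (\<Pi>\<^sub>E i\<in>{..<c}. {u ! i}) \<longleftrightarrow> (\<forall>i<c. \<omega> i = u ! i)"
        by (auto simp: PiE_def Pi_def)
      then show "\<omega> \<in> {\<omega>. \<forall>i<c. \<omega> i = u ! i} \<longleftrightarrow> \<omega> \<in> prod_emb UNIV
          (\<lambda>n. measure_pmf (bernoulli_pmf (1/2))) {..<c} (\<Pi>\<^sub>E i\<in>{..<c}. {u ! i})"
        unfolding prod_emb_def by (simp only: mem_Collect_eq) simp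
    qed
    finally show ?thesis .
  qed
  show "{\<omega>. map \<omega> [0..<c] = u} \<in> sets fair_coins"
    unfolding e fair_coins_def by (intro sets_PiM_I) auto
  show "measure fair_coins {\<omega>. map \<omega> [0..<c] = u} = 1 / 2 ^ c"
    unfolding e fair_coins_def
    by (subst measure_PiM_emb) (simp_all add: measure_pmf_single power_one_over)
qed

text \<open>Cylinders over distinct words are disjoint and each has probability
  \<open>1 / 2 ^ c\<close>, so a probability becomes a count of words.\<close>

lemma fair_coins_prefix:
  shows "measure fair_coins {\<omega>. Q (map \<omega> [0..<c])} = card {u. length u = c \<and> Q u} / 2 ^ c"
proof -
  interpret prob_space fair_coins by (rule prob_space_fair_coins)
  let ?U = "{u. length u = c \<and> Q u}"
  have "{\<omega>. Q (map \<omega> [0..<c])} = (\<Union>u\<in>?U. {\<omega>. map \<omega> [0..<c] = u})" by auto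
  then have "measure fair_coins {\<omega>. Q (map \<omega> [0..<c])} = 
      measure fair_coins (\<Union>u\<in>?U. {\<omega>. map \<omega> [0..<c] = u})" by simp
  also have "\<dots> = (\<Sum>u\<in>?U. measure fair_coins {\<omega>. map \<omega> [0..<c] = u})"
    using fair_coins_cylinder(1) finite_bool_lists
    by (intro finite_measure_finite_Union) (auto simp: disjoint_family_on_def)
  also have "\<dots> = (\<Sum>u\<in>?U. 1 / 2 ^ c)"
    using fair_coins_cylinder(2) by (intro sum.cong) auto
  finally show ?thesis by simp
qed

section \<open>Protocols with many heads\<close>

text \<open>
  The list of heads in a verifier state contains the heads to be tracked in the current and in
  the following rounds. The sweeps realise the wraparound of a digit: they carry the input head
  from one endmarker to the other.
\<close>

datatype ('s, 'm) vstate =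
    Acc
  | Rej
  | Coins "bool list"
  | Rewind "nat list"
  | PTurn "nat list" 's
  | RTurn "nat list" 's 'm
  | SweepL "nat list" 's
  | SweepR "nat list" 's

datatype 's outcome = Win | Lose | Again | Next 's

text \<open>Positions run from \<open>0\<close> to \<open>n + 1\<close>. Joining the two ends makes
  a head count modulo \<open>n + 2\<close>, as a digit does.\<close>

definition cyclic_move :: "nat \<Rightarrow> dir \<Rightarrow> nat \<Rightarrow> nat" where
  "cyclic_move n m h = (case m of
       MoveL \<Rightarrow> if h = 0 then n + 1 else h - 1
     | Stay \<Rightarrow> h
     | MoveR \<Rightarrow> if h = n + 1 then 0 else h + 1)"

lemma cyclic_move_le: "h \<le> n + 1 \<Longrightarrow> cyclic_move n m h \<le> n + 1"
  by (auto simp: cyclic_move_def split: dir.split)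

lemma input_tape_nth:
  assumes "h \<le> length w + 1"
  shows "input_tape w ! h = (if h = 0 then LeftEnd else if h = length w + 1 then RightEnd
    else Sym (w ! (h - 1)))"
  using assms by (cases h) (auto simp: input_tape_def nth_append)

lemma input_tape_LeftEnd: "h \<le> length w + 1 \<Longrightarrow> input_tape w ! h = LeftEnd \<longleftrightarrow> h = 0"
  and input_tape_RightEnd: "h \<le> length w + 1 \<Longrightarrow> input_tape w ! h = RightEnd \<longleftrightarrow> h = length w + 1"
  by (auto simp: input_tape_nth)

text \<open>
  A game in which the prover sends messages from \<open>PM\<close> and the refuter replies from \<open>RM\<close>, with
  \<open>K\<close> imaginary heads moving cyclically over the input tape and \<open>N\<close> rounds. The heads start on the
  left endmarker, those satisfying \<open>ini\<close> one cell to its right. The symbol that \<open>m\<close> announces for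
  head \<open>i\<close> is \<open>obs m i\<close>.
\<close>

locale protocol =
  fixes \<Sigma> :: "'a set"
    and K N :: nat
    and S :: "'s set"
    and PM :: "'m set"
    and RM :: "'y set"
    and s0 :: 's
    and ini :: "nat \<Rightarrow> bool"
    and obs :: "'m \<Rightarrow> nat \<Rightarrow> 'a input_symbol"
    and ruling :: "'s \<Rightarrow> 'm \<Rightarrow> 'y \<Rightarrow> 's outcome"
    and head_move :: "'s \<Rightarrow> 'm \<Rightarrow> 'y \<Rightarrow> nat \<Rightarrow> dir"
    and doubt :: 'y
  assumes K_pos: "K > 0" and N_pos: "N > 0"
    and finite_S: "finite S" and finite_PM: "finite PM" and finite_RM: "finite RM"
    and PM_nonempty: "PM \<noteq> {}"
    and s0: "s0 \<in> S" and doubt: "doubt \<in> RM"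
    and ruling_closed: "\<lbrakk>s \<in> S; m \<in> PM; y \<in> RM; ruling s m y = Next s'\<rbrakk> \<Longrightarrow> s' \<in> S"
    and ruling_doubt: "ruling s m doubt = Again"
begin

section \<open>The finite-state verifier\<close>

definition heads :: "nat list set" where
  "heads = {hs. hs \<noteq> [] \<and> set hs \<subseteq> {..<K} \<and> length hs \<le> N}"

primrec vstate_ok :: "('s, 'm) vstate \<Rightarrow> bool" where
  "vstate_ok Acc \<longleftrightarrow> True"
| "vstate_ok Rej \<longleftrightarrow> True"
| "vstate_ok (Coins u) \<longleftrightarrow> length u \<le> N * K"
| "vstate_ok (Rewind hs) \<longleftrightarrow> hs \<in> heads"
| "vstate_ok (PTurn hs s) \<longleftrightarrow> hs \<in> heads \<and> s \<in> S"
| "vstate_ok (RTurn hs s m) \<longleftrightarrow> hs \<in> heads \<and> s \<in> S \<and> m \<in> PM"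
| "vstate_ok (SweepL hs s) \<longleftrightarrow> hs \<in> heads \<and> s \<in> S"
| "vstate_ok (SweepR hs s) \<longleftrightarrow> hs \<in> heads \<and> s \<in> S"

definition vstates :: "('s, 'm) vstate set" where
  "vstates = {v. vstate_ok v}"

lemma vstates_iff [simp]: "v \<in> vstates \<longleftrightarrow> vstate_ok v"
  by (simp add: vstates_def)

lemma finite_vstates: "finite vstates"
proof -
  let ?F = "{Acc, Rej} \<union> (\<Union>u\<in>{u. length u \<le> N * K}. {Coins u})
     \<union> (\<Union>hs\<in>heads. {Rewind hs} \<union> (\<Union>s\<in>S. {PTurn hs s, SweepL hs s, SweepR hs s}
          \<union> (\<Union>m\<in>PM. {RTurn hs s m})))"
  have "finite heads"
    by (rule finite_subset[OF _ finite_lists_length_le[of "{..<K}" N]]) (auto simp: heads_def)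
  moreover have "finite {u :: bool list. length u \<le> N * K}"
    using finite_lists_length_le[of "UNIV :: bool set" "N * K"] by simp
  ultimately have "finite ?F"
    using finite_S finite_PM by simp
  moreover have "v \<in> ?F" if "vstate_ok v" for v
    using that by (cases v) auto
  ultimately show ?thesis
    unfolding vstates_def by (metis (no_types, lifting) finite_subset mem_Collect_eq subsetI)
qed

definition enc :: "('s, 'm) vstate \<Rightarrow> nat" where "enc = code vstates"

definition dec :: "nat \<Rightarrow> ('s, 'm) vstate" where "dec = decode vstates"

definition menc :: "'m + 'y \<Rightarrow> nat" where "menc = code (PM <+> RM)"

definition mdec :: "nat \<Rightarrow> 'm + 'y" where "mdec = decode (PM <+> RM)"

lemma dec_enc [simp]: "v \<in> vstates \<Longrightarrow> dec (enc v) = v"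
  unfolding dec_def enc_def by (rule decode_code[OF finite_vstates])

lemma enc_eq_iff [simp]: "v \<in> vstates \<Longrightarrow> v' \<in> vstates \<Longrightarrow> enc v = enc v' \<longleftrightarrow> v = v'"
  by (metis dec_enc)

lemma mdec_menc [simp]:
  "m \<in> PM \<Longrightarrow> mdec (menc (Inl m)) = Inl m" "y \<in> RM \<Longrightarrow> mdec (menc (Inr y)) = Inr y"
  unfolding mdec_def menc_def using decode_code[OF finite_Plus[OF finite_PM finite_RM]] by blast+

text \<open>Only the symbol announced for the first head of the list is compared with the tape, and
  this happens before the reply is read. Rewinding and sweeping leave the debate head in place, so
  messages are read at even indices and replies at odd ones.\<close>

fun vnext :: "('s, 'm) vstate \<Rightarrow> 'a input_symbol \<Rightarrow> 'm + 'y \<Rightarrow> ('s, 'm) vstate \<times> dir \<times> bool" where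
  "vnext (Coins u) x g = (Rewind (chosen_heads K N u), Stay, False)"
| "vnext (Rewind hs) x g =
     (if x = LeftEnd then (PTurn hs s0, if ini (hd hs) then MoveR else Stay, False)
      else (Rewind hs, MoveL, False))"
| "vnext (PTurn hs s) x (Inl m) =
     (if obs m (hd hs) = x then (RTurn hs s m, Stay, True) else (Rej, Stay, False))"
| "vnext (RTurn hs s m) x (Inr y) =
     (case ruling s m y of
        Win \<Rightarrow> (Acc, Stay, False)
      | Lose \<Rightarrow> (Rej, Stay, False)
      | Again \<Rightarrow> (if tl hs = [] then Acc else Rewind (tl hs), Stay, True)
      | Next s' \<Rightarrow>
         (case head_move s m y (hd hs) of
            Stay \<Rightarrow> (PTurn hs s', Stay, True)
          | MoveL \<Rightarrow> if x = LeftEnd then (SweepR hs s', Stay, True) else (PTurn hs s', MoveL, True)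
          | MoveR \<Rightarrow> if x = RightEnd then (SweepL hs s', Stay, True) else (PTurn hs s', MoveR, True)))"
| "vnext (SweepL hs s) x g =
     (if x = LeftEnd then (PTurn hs s, Stay, False) else (SweepL hs s, MoveL, False))"
| "vnext (SweepR hs s) x g =
     (if x = RightEnd then (PTurn hs s, Stay, False) else (SweepR hs s, MoveR, False))"
| "vnext v x g = (Rej, Stay, False)"

definition encode_transition :: "('s, 'm) vstate \<times> dir \<times> bool \<Rightarrow> transition" where
  "encode_transition = map_prod enc id"

text \<open>The coins for all rounds are tossed at the start. The rest of the run is deterministic,
  which bounds the tosses even in branches that never halt.\<close>

definition vdelta :: "nat \<Rightarrow> 'a input_symbol \<Rightarrow> nat \<Rightarrow> action" where
  "vdelta q x g = (case dec q of
       Coins u \<Rightarrow>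
         if length u < N * K
         then Toss (enc (Coins (u @ [True])), Stay, False) (enc (Coins (u @ [False])), Stay, False)
         else Det (encode_transition (vnext (Coins u) x (mdec g)))
     | v \<Rightarrow> Det (encode_transition (vnext v x (mdec g))))"

definition V :: "'a verifier" where
  "V = \<lparr>states = enc ` vstates, prover_symbols = menc ` Inl ` PM, refuter_symbols = menc ` Inr ` RM,
     start = enc (Coins []), accept = enc Acc, reject = enc Rej, delta = vdelta\<rparr>"

lemma V_simps [simp]:
  "states V = enc ` vstates" "prover_symbols V = menc ` Inl ` PM" "refuter_symbols V = menc ` Inr ` RM"
  "start V = enc (Coins [])" "accept V = enc Acc" "reject V = enc Rej" "delta V = vdelta"
  by (simp_all add: V_def)

lemma chosen_heads_in_heads: "chosen_heads K N u \<in> heads"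
proof -
  have "chosen_heads K N u \<noteq> []" using N_pos length_chosen_heads[of K N u] by force
  then show ?thesis using set_chosen_heads[OF K_pos, of N u] by (simp add: heads_def)
qed

lemma tl_heads: "hs \<in> heads \<Longrightarrow> tl hs \<noteq> [] \<Longrightarrow> tl hs \<in> heads"
  by (cases hs) (auto simp: heads_def)

lemma vnext_closed:
  assumes "vstate_ok v" "g \<in> PM <+> RM"
  shows "vstate_ok (fst (vnext v x g))"
proof (cases v)
  case (PTurn hs s)
  then show ?thesis using assms by (cases g) auto
next
  case (RTurn hs s m)
  show ?thesis
  proof (cases g)
    case (Inr y)
    then show ?thesis
      using RTurn assms tl_heads[of hs] ruling_closed[of s m y]
      by (auto split: outcome.split dir.split)
  qed (simp add: RTurn)
qed (use assms chosen_heads_in_heads s0 in auto)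

lemma vnext_move:
  assumes "vnext v x g = (v', m, adv)"
  shows "x = LeftEnd \<Longrightarrow> m \<noteq> MoveL" "x = RightEnd \<Longrightarrow> m \<noteq> MoveR"
  using assms
  by (cases v; cases g; auto split: outcome.splits dir.splits if_splits)+

lemma debate_symbol:
  assumes "g \<in> debate_symbols V"
  shows "mdec g \<in> PM <+> RM"
proof -
  from assms consider m where "m \<in> PM" "g = menc (Inl m)" | y where "y \<in> RM" "g = menc (Inr y)"
    unfolding V_simps by blast
  then show ?thesis by cases (simp_all add: Plus_def)
qed

lemma vdelta_cases:
  assumes "v \<in> vstates"
  shows "(\<exists>u. v = Coins u \<and> length u < N * K \<and> vdelta (enc v) x g =
        Toss (enc (Coins (u @ [True])), Stay, False) (enc (Coins (u @ [False])), Stay, False))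
    \<or> (\<forall>u. v = Coins u \<longrightarrow> length u = N * K) \<and>
       vdelta (enc v) x g = Det (encode_transition (vnext v x (mdec g)))"
  using assms by (cases v) (auto simp: vdelta_def)

lemma wf_V: "wf_verifier \<Sigma> V"
proof -
  have "fst \<tau> \<in> states V \<and> (x = LeftEnd \<longrightarrow> fst (snd \<tau>) \<noteq> MoveL) \<and> (x = RightEnd \<longrightarrow> fst (snd \<tau>) \<noteq> MoveR)"
    if q: "q \<in> states V" and g: "g \<in> debate_symbols V" and \<tau>: "\<tau> \<in> transitions (vdelta q x g)"
    for q x g \<tau>
  proof -
    obtain v where v: "v \<in> vstates" "q = enc v" using q by auto
    note debate_symbol[OF g]
    with v(1) have ok: "vstate_ok (fst (vnext v x (mdec g)))" by (intro vnext_closed) auto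
    obtain v' m adv where n: "vnext v x (mdec g) = (v', m, adv)" by (cases "vnext v x (mdec g)")
    from vdelta_cases[OF v(1), of x g] show ?thesis
      using \<tau> ok vnext_move[OF n] by (auto simp: v(2) n encode_transition_def)
  qed
  note * = this
  have "\<forall>q \<in> states V - {accept V, reject V}. \<forall>x \<in> {LeftEnd, RightEnd} \<union> Sym ` \<Sigma>.
        \<forall>g \<in> debate_symbols V. \<forall>(q', m, adv) \<in> transitions (delta V q x g).
          q' \<in> states V \<and> (x = LeftEnd \<longrightarrow> m \<noteq> MoveL) \<and> (x = RightEnd \<longrightarrow> m \<noteq> MoveR)"
  proof (intro ballI)
    fix q x g \<tau>
    assume "q \<in> states V - {accept V, reject V}" "g \<in> debate_symbols V" "\<tau> \<in> transitions (delta V q x g)"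
    then show "case \<tau> of (q', m, adv) \<Rightarrow>
        q' \<in> states V \<and> (x = LeftEnd \<longrightarrow> m \<noteq> MoveL) \<and> (x = RightEnd \<longrightarrow> m \<noteq> MoveR)"
      using *[of q g \<tau> x] by (cases \<tau>) simp
  qed
  moreover have "menc ` Inl ` PM \<inter> menc ` Inr ` RM = {}"
  proof -
    have "menc (Inl m) \<noteq> menc (Inr y)" if "m \<in> PM" "y \<in> RM" for m y
      using mdec_menc(1)[OF that(1)] mdec_menc(2)[OF that(2)] by auto
    then show ?thesis by blast
  qed
  moreover have "RM \<noteq> {}" using doubt by auto
  ultimately show ?thesis
    unfolding wf_verifier_def
    using finite_vstates finite_PM finite_RM PM_nonempty by (simp; blast)
qed


section \<open>Runs of the verifier\<close>

definition halts :: "'a list \<Rightarrow> (nat \<Rightarrow> nat) \<Rightarrow> (nat \<Rightarrow> bool) \<Rightarrow> config \<Rightarrow> ('s, 'm) vstate \<Rightarrow> bool" where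
  "halts w d \<omega> cfg v \<longleftrightarrow> (\<exists>t. config_state ((verifier_step V w d \<omega> ^^ t) cfg) = enc v)"

lemma halts_now: "halts w d \<omega> (enc v, i, j, k) v"
  unfolding halts_def config_state_def by (rule exI[of _ 0]) simp

lemma halts_funpow:
  assumes "halts w d \<omega> ((verifier_step V w d \<omega> ^^ n) cfg) v"
  shows "halts w d \<omega> cfg v"
proof -
  obtain t where "config_state ((verifier_step V w d \<omega> ^^ t) ((verifier_step V w d \<omega> ^^ n) cfg)) = enc v"
    using assms unfolding halts_def by blast
  then have "config_state ((verifier_step V w d \<omega> ^^ (t + n)) cfg) = enc v"
    by (simp add: funpow_add)
  then show ?thesis unfolding halts_def by blast
qed

lemma step_det:
  assumes "vstate_ok v" "v \<noteq> Acc" "v \<noteq> Rej" "\<And>u. v = Coins u \<Longrightarrow> length u = N * K"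
  shows "verifier_step V w d \<omega> (enc v, i, j, k) =
    apply_transition (encode_transition (vnext v (input_tape w ! i) (mdec (d j)))) i j k"
proof -
  have "vdelta (enc v) x g = Det (encode_transition (vnext v x (mdec g)))" for x g
    using vdelta_cases[of v x g] assms by auto
  then show ?thesis using assms by simp
qed

lemma step_toss:
  assumes "length u < N * K"
  shows "verifier_step V w d \<omega> (enc (Coins u), i, j, k) = (enc (Coins (u @ [\<omega> k])), i, j, k + 1)"
  using assms by (simp add: vdelta_def)

text \<open>Runs are followed backwards from the verdict: rules of this kind reduce the fate of a
  configuration to that of a later one, without counting steps.\<close>

lemma halts_det:
  assumes "halts w d \<omega> (enc v', move m i, if adv then j + 1 else j, k) r"
    and "vnext v (input_tape w ! i) (mdec (d j)) = (v', m, adv)"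
    and "vstate_ok v" "v \<noteq> Acc" "v \<noteq> Rej" "\<And>u. v = Coins u \<Longrightarrow> length u = N * K"
  shows "halts w d \<omega> (enc v, i, j, k) r"
proof -
  have "verifier_step V w d \<omega> (enc v, i, j, k) = (enc v', move m i, if adv then j + 1 else j, k)"
    using step_det[OF assms(3-6), of w d \<omega> i j k] assms(2) by (simp add: encode_transition_def)
  then have "halts w d \<omega> ((verifier_step V w d \<omega> ^^ 1) (enc v, i, j, k)) r"
    using assms(1) by simp
  then show ?thesis by (rule halts_funpow)
qed

lemma halts_SweepL:
  assumes "halts w d \<omega> (enc (PTurn hs s), 0, j, k) r" "hs \<in> heads" "s \<in> S" "i \<le> length w + 1"
  shows "halts w d \<omega> (enc (SweepL hs s), i, j, k) r"
  using assms(4)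
proof (induction i)
  case 0
  show ?case
    by (rule halts_det[where v' = "PTurn hs s" and m = Stay and adv = False])
      (use assms in \<open>auto simp: input_tape_nth\<close>)
next
  case (Suc i)
  show ?case
    by (rule halts_det[where v' = "SweepL hs s" and m = MoveL and adv = False])
      (use assms Suc in \<open>auto simp: input_tape_nth\<close>)
qed

lemma halts_SweepR:
  assumes "halts w d \<omega> (enc (PTurn hs s), length w + 1, j, k) r" "hs \<in> heads" "s \<in> S" "i \<le> length w + 1"
  shows "halts w d \<omega> (enc (SweepR hs s), i, j, k) r"
  using assms(4)
proof (induction "length w + 1 - i" arbitrary: i)
  case 0
  then have i: "i = length w + 1" by simp
  show ?case
    by (rule halts_det[where v' = "PTurn hs s" and m = Stay and adv = False])
      (use assms in \<open>auto simp: input_tape_nth i\<close>)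
next
  case (Suc x)
  then have "halts w d \<omega> (enc (SweepR hs s), i + 1, j, k) r" by simp
  show ?case
    by (rule halts_det[where v' = "SweepR hs s" and m = MoveR and adv = False])
      (use assms Suc \<open>halts w d \<omega> (enc (SweepR hs s), i + 1, j, k) r\<close> in \<open>auto simp: input_tape_nth\<close>)
qed

definition initial_heads :: "nat \<Rightarrow> nat" where
  "initial_heads i = of_bool (ini i)"

lemma halts_Rewind:
  assumes "halts w d \<omega> (enc (PTurn hs s0), initial_heads (hd hs), j, k) r" "hs \<in> heads" "i \<le> length w + 1"
  shows "halts w d \<omega> (enc (Rewind hs), i, j, k) r"
  using assms(3)
proof (induction i)
  case 0
  show ?case
    by (rule halts_det[where v' = "PTurn hs s0" and m = "if ini (hd hs) then MoveR else Stay" and adv = False])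
      (use assms in \<open>auto simp: input_tape_nth initial_heads_def\<close>)
next
  case (Suc i)
  show ?case
    by (rule halts_det[where v' = "Rewind hs" and m = MoveL and adv = False])
      (use assms Suc in \<open>auto simp: input_tape_nth\<close>)
qed

lemma halts_mismatch:
  assumes "hs \<in> heads" "s \<in> S" "m \<in> PM" "d j = menc (Inl m)" "obs m (hd hs) \<noteq> input_tape w ! i"
  shows "halts w d \<omega> (enc (PTurn hs s), i, j, k) Rej"
  by (rule halts_det[where v' = Rej and m = Stay and adv = False]) (use assms halts_now in auto)

text \<open>A message and its reply move the real head like the tracked imaginary one, because a
  move past an endmarker is completed by a sweep. After a doubt the head is rewound and the next
  entry of the list is tracked.\<close>

lemma halts_turn:
  assumes "hs \<in> heads" "s \<in> S" "m \<in> PM" "y \<in> RM"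
    and "d j = menc (Inl m)" "d (j + 1) = menc (Inr y)" "i \<le> length w + 1"
    and "obs m (hd hs) = input_tape w ! i"
    and "case ruling s m y of
        Win \<Rightarrow> r = Acc
      | Lose \<Rightarrow> r = Rej
      | Again \<Rightarrow> if tl hs = [] then r = Acc
          else halts w d \<omega> (enc (PTurn (tl hs) s0), initial_heads (hd (tl hs)), j + 2, k) r
      | Next s' \<Rightarrow> halts w d \<omega> (enc (PTurn hs s'), cyclic_move (length w) (head_move s m y (hd hs)) i, j + 2, k) r"
  shows "halts w d \<omega> (enc (PTurn hs s), i, j, k) r"
proof -
  note turn = halts_det[where w = w and d = d and \<omega> = \<omega> and v = "RTurn hs s m" and i = i and
      j = "j + 1" and k = k and r = r]
  have "halts w d \<omega> (enc (RTurn hs s m), i, j + 1, k) r"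
  proof (cases "ruling s m y")
    case Win
    then show ?thesis
      using assms by (intro turn[where v' = Acc and m = Stay and adv = False]) (auto simp: halts_now)
  next
    case Lose
    then show ?thesis
      using assms by (intro turn[where v' = Rej and m = Stay and adv = False]) (auto simp: halts_now)
  next
    case Again
    show ?thesis
    proof (cases "tl hs = []")
      case True
      then show ?thesis
        using assms Again by (intro turn[where v' = Acc and m = Stay and adv = True]) (auto simp: halts_now)
    next
      case False
      then have "halts w d \<omega> (enc (Rewind (tl hs)), i, j + 2, k) r"
        using assms Again by (intro halts_Rewind tl_heads) auto
      then show ?thesis
        using assms Again False by (intro turn[where v' = "Rewind (tl hs)" and m = Stay and adv = True]) auto
    qed
  next
    case (Next s')
    have s': "s' \<in> S" using ruling_closed assms(2-4) Next by blast
    have h: "halts w d \<omega> (enc (PTurn hs s'), cyclic_move (length w) (head_move s m y (hd hs)) i, j + 2, k) r"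
      using assms(9) Next by simp
    show ?thesis
    proof (cases "head_move s m y (hd hs)")
      case Stay
      then show ?thesis
        using assms Next h by (intro turn[where v' = "PTurn hs s'" and m = Stay and adv = True]) (auto simp: cyclic_move_def)
    next
      case MoveL
      show ?thesis
      proof (cases "i = 0")
        case True
        then have "halts w d \<omega> (enc (SweepR hs s'), i, j + 2, k) r"
          using h MoveL assms(1,7) s' by (intro halts_SweepR) (auto simp: cyclic_move_def)
        then show ?thesis
          using assms Next MoveL True
          by (intro turn[where v' = "SweepR hs s'" and m = Stay and adv = True]) (auto simp: input_tape_nth)
      next
        case False
        then show ?thesis
          using assms Next MoveL h
          by (intro turn[where v' = "PTurn hs s'" and m = MoveL and adv = True]) (auto simp: cyclic_move_def input_tape_nth)
      qed
    next
      case MoveR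
      show ?thesis
      proof (cases "i = length w + 1")
        case True
        then have "halts w d \<omega> (enc (SweepL hs s'), i, j + 2, k) r"
          using h MoveR assms(1,7) s' by (intro halts_SweepL) (auto simp: cyclic_move_def)
        then show ?thesis
          using assms Next MoveR True
          by (intro turn[where v' = "SweepL hs s'" and m = Stay and adv = True]) (auto simp: input_tape_nth)
      next
        case False
        then show ?thesis
          using assms Next MoveR h
          by (intro turn[where v' = "PTurn hs s'" and m = MoveR and adv = True]) (auto simp: cyclic_move_def input_tape_nth)
      qed
    qed
  qed
  note * = this
  show ?thesis
    by (rule halts_det[where v' = "RTurn hs s m" and m = Stay and adv = True]) (use assms * in auto)
qed

lemma run_coins:
  assumes "c \<le> N * K"
  shows "(verifier_step V w d \<omega> ^^ c) (start V, 0, 0, 0) = (enc (Coins (map \<omega> [0..<c])), 0, 0, c)"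
  using assms
proof (induction c)
  case (Suc c)
  then have "(verifier_step V w d \<omega> ^^ Suc c) (start V, 0, 0, 0) =
      verifier_step V w d \<omega> (enc (Coins (map \<omega> [0..<c])), 0, 0, c)" by simp
  also have "\<dots> = (enc (Coins (map \<omega> [0..<c] @ [\<omega> c])), 0, 0, c + 1)"
    using Suc.prems by (intro step_toss) simp
  finally show ?case by simp
qed simp

lemma halts_start:
  assumes "hs = chosen_heads K N (map \<omega> [0..<N * K])"
    and "halts w d \<omega> (enc (PTurn hs s0), initial_heads (hd hs), 0, N * K) r"
  shows "halts w d \<omega> (start V, 0, 0, 0) r"
proof (rule halts_funpow[where n = "N * K"])
  have hs: "hs \<in> heads" using assms(1) chosen_heads_in_heads by simp
  have rewound: "halts w d \<omega> (enc (Rewind hs), 0, 0, N * K) r"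
    using assms(2) hs by (intro halts_Rewind) auto
  have "halts w d \<omega> (enc (Coins (map \<omega> [0..<N * K])), 0, 0, N * K) r"
    by (rule halts_det[where v' = "Rewind hs" and m = Stay and adv = False]) (use assms rewound in auto)
  then show "halts w d \<omega> ((verifier_step V w d \<omega> ^^ (N * K)) (start V, 0, 0, 0)) r"
    unfolding run_coins[OF order_refl] .
qed

section \<open>Bound on the coins\<close>

definition config_ok :: "config \<Rightarrow> bool" where
  "config_ok = (\<lambda>(q, i, j, k). \<exists>v. vstate_ok v \<and> q = enc v \<and> k \<le> N * K \<and> (\<forall>u. v = Coins u \<longrightarrow> length u = k))"

text \<open>Coins are tossed only in a state \<open>Coins u\<close> with
  \<open>length u < N * K\<close>, and there the invariant identifies the number of earlier tosses
  with \<open>length u\<close>. Hence no coin with index \<open>N * K\<close> or above is ever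
  read.\<close>

lemma config_ok_step:
  assumes "config_ok cfg" "\<And>j. mdec (d j) \<in> PM <+> RM"
  shows "config_ok (verifier_step V w d \<omega> cfg)"
    and "(\<And>k. k < N * K \<Longrightarrow> \<omega> k = \<omega>' k) \<Longrightarrow> verifier_step V w d \<omega> cfg = verifier_step V w d \<omega>' cfg"
proof -
  obtain q i j k where cfg: "cfg = (q, i, j, k)" by (cases cfg) auto
  obtain v where v: "vstate_ok v" "q = enc v" "k \<le> N * K" "\<And>u. v = Coins u \<Longrightarrow> length u = k"
    using assms(1) by (auto simp: config_ok_def cfg)
  have "config_ok (verifier_step V w d \<omega> cfg) \<and>
    ((\<forall>k < N * K. \<omega> k = \<omega>' k) \<longrightarrow> verifier_step V w d \<omega> cfg = verifier_step V w d \<omega>' cfg)"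
  proof (cases "v = Acc \<or> v = Rej")
    case True
    then show ?thesis using assms(1) v by (auto simp: cfg)
  next
    case False
    show ?thesis
    proof (cases "\<exists>u. v = Coins u \<and> length u < N * K")
      case True
      then obtain u where u: "v = Coins u" "length u < N * K" by blast
      then have k: "k < N * K" "length u = k" using v by auto
      have "config_ok (enc (Coins (u @ [\<omega> k])), i, j, k + 1)"
        unfolding config_ok_def using k by (auto intro!: exI[of _ "Coins (u @ [\<omega> k])"] simp del: enc_eq_iff)
      then show ?thesis
        using k unfolding cfg v(2) u(1) step_toss[OF u(2)] by simp
    next
      case nt: False
      have full: "length u = N * K" if "v = Coins u" for u
        using nt v that by fastforce
      obtain v' m adv where n: "vnext v (input_tape w ! i) (mdec (d j)) = (v', m, adv)"
        by (cases "vnext v (input_tape w ! i) (mdec (d j))")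
      have "vstate_ok v'"
        using vnext_closed[OF v(1) assms(2)[of j], of "input_tape w ! i"] n by simp
      moreover have "v' \<noteq> Coins u" for u
        using n by (cases v; cases "mdec (d j)"; auto split: outcome.splits dir.splits if_splits)
      moreover have step: "verifier_step V w d \<omega> cfg = (enc v', move m i, if adv then j + 1 else j, k)" for \<omega>
        using step_det[of v w d \<omega> i j k] v(1) False full unfolding cfg v(2) n encode_transition_def by simp
      ultimately show ?thesis
        unfolding step using v(3) by (auto simp: config_ok_def)
    qed
  qed
  then show "config_ok (verifier_step V w d \<omega> cfg)"
    and "(\<And>k. k < N * K \<Longrightarrow> \<omega> k = \<omega>' k) \<Longrightarrow> verifier_step V w d \<omega> cfg = verifier_step V w d \<omega>' cfg"
    by blast+
qed

lemma config_ok_run: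
  assumes "\<And>j. mdec (d j) \<in> PM <+> RM"
  shows "config_ok ((verifier_step V w d \<omega> ^^ t) (start V, 0, 0, 0))"
proof (induction t)
  case 0
  show ?case unfolding config_ok_def V_simps by (auto intro!: exI[of _ "Coins []"])
qed (simp add: config_ok_step(1) assms del: V_simps verifier_step.simps)

text \<open>This makes the verdict a function of the first \<open>N * K\<close> coins, so that its
  probability can be found by counting.\<close>

lemma run_agree:
  assumes "\<And>j. mdec (d j) \<in> PM <+> RM" "\<And>k. k < N * K \<Longrightarrow> \<omega> k = \<omega>' k"
  shows "(verifier_step V w d \<omega> ^^ t) (start V, 0, 0, 0) = (verifier_step V w d \<omega>' ^^ t) (start V, 0, 0, 0)"
proof (induction t)
  case (Suc t)
  have "verifier_step V w d \<omega> ((verifier_step V w d \<omega>' ^^ t) (start V, 0, 0, 0)) =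
      verifier_step V w d \<omega>' ((verifier_step V w d \<omega>' ^^ t) (start V, 0, 0, 0))"
    using assms by (intro config_ok_step(2) config_ok_run)
  then show ?case using Suc by (simp del: V_simps verifier_step.simps)
qed simp

section \<open>Debates of legal strategies\<close>

lemma prover_symbol:
  assumes "P \<in> prover_strategies \<Sigma> V" "w \<in> lists \<Sigma>" "pre \<in> lists (debate_symbols V)"
  shows "P w pre \<in> prover_symbols V"
  using assms(1) unfolding prover_strategies_def by (rule funcset_mem[OF funcset_mem[OF _ assms(2)] assms(3)])

lemma refuter_symbol:
  assumes "R \<in> refuter_strategies \<Sigma> V" "w \<in> lists \<Sigma>" "pre \<in> lists (debate_symbols V)"
  shows "R w pre \<in> refuter_symbols V"
  using assms(1) unfolding refuter_strategies_def by (rule funcset_mem[OF funcset_mem[OF _ assms(2)] assms(3)])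

lemma debate_prefix_lists:
  assumes "w \<in> lists \<Sigma>" "P \<in> prover_strategies \<Sigma> V" "R \<in> refuter_strategies \<Sigma> V"
  shows "debate_prefix P R w n \<in> lists (debate_symbols V)"
proof (induction n)
  case (Suc n)
  then show ?case
    using prover_symbol[OF assms(2,1) Suc] refuter_symbol[OF assms(3,1) Suc] by simp
qed simp

lemma debate_even:
  assumes "w \<in> lists \<Sigma>" "P \<in> prover_strategies \<Sigma> V" "R \<in> refuter_strategies \<Sigma> V"
  obtains m where "m \<in> PM" "debate P R w (2 * \<tau>) = menc (Inl m)"
  using prover_symbol[OF assms(2,1) debate_prefix_lists[OF assms, of "2 * \<tau>"]]
  by (fastforce simp: debate_def)

lemma debate_odd:
  assumes "w \<in> lists \<Sigma>" "P \<in> prover_strategies \<Sigma> V" "R \<in> refuter_strategies \<Sigma> V"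
  obtains y where "y \<in> RM" "debate P R w (2 * \<tau> + 1) = menc (Inr y)"
  using refuter_symbol[OF assms(3,1) debate_prefix_lists[OF assms, of "2 * \<tau> + 1"]]
  by (fastforce simp: debate_def simp del: debate_prefix.simps)

lemma debate_ok:
  assumes "w \<in> lists \<Sigma>" "P \<in> prover_strategies \<Sigma> V" "R \<in> refuter_strategies \<Sigma> V"
  shows "mdec (debate P R w j) \<in> PM <+> RM"
proof (cases "even j")
  case True
  then obtain \<tau> where j: "j = 2 * \<tau>" by blast
  obtain m where "m \<in> PM" "debate P R w j = menc (Inl m)" using debate_even[OF assms] j by blast
  then show ?thesis by (simp add: Plus_def)
next
  case False
  then obtain \<tau> where j: "j = 2 * \<tau> + 1" using oddE by blast
  obtain y where "y \<in> RM" "debate P R w j = menc (Inr y)" using debate_odd[OF assms] j by blast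
  then show ?thesis by (simp add: Plus_def)
qed

lemma tosses_at_most_V: "tosses_at_most \<Sigma> V (N * K)"
  unfolding tosses_at_most_def
proof (intro ballI allI)
  fix w P R \<omega> t
  assume "w \<in> lists \<Sigma>" "P \<in> prover_strategies \<Sigma> V" "R \<in> refuter_strategies \<Sigma> V"
  then have "config_ok (verifier_run V P R w \<omega> t)"
    unfolding verifier_run_def by (intro config_ok_run debate_ok)
  then show "coins_tossed (verifier_run V P R w \<omega> t) \<le> N * K"
    by (auto simp: config_ok_def coins_tossed_def split: prod.splits)
qed


section \<open>Positions of the game and optimal moves\<close>

definition truthful :: "'a list \<Rightarrow> (nat \<Rightarrow> nat) \<Rightarrow> 'm \<Rightarrow> bool" where
  "truthful w h m \<longleftrightarrow> (\<forall>i<K. obs m i = input_tape w ! h i)"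

definition move_heads :: "'a list \<Rightarrow> 's \<Rightarrow> 'm \<Rightarrow> 'y \<Rightarrow> (nat \<Rightarrow> nat) \<Rightarrow> nat \<Rightarrow> nat" where
  "move_heads w s m y h = (\<lambda>i. cyclic_move (length w) (head_move s m y i) (h i))"

text \<open>
  The index bounds the number of turns that are left in the round. A player who always chooses
  with respect to the least index makes progress although the choice depends on the position only.
\<close>

primrec prover_wins :: "nat \<Rightarrow> 'a list \<Rightarrow> 's \<Rightarrow> (nat \<Rightarrow> nat) \<Rightarrow> bool" where
  "prover_wins 0 w s h \<longleftrightarrow> False"
| "prover_wins (Suc k) w s h \<longleftrightarrow> (\<exists>m\<in>PM. truthful w h m \<and> (\<forall>y\<in>RM. case ruling s m y of
      Win \<Rightarrow> True | Lose \<Rightarrow> False | Again \<Rightarrow> True | Next s' \<Rightarrow> prover_wins k w s' (move_heads w s m y h)))"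

primrec refuter_wins :: "nat \<Rightarrow> 'a list \<Rightarrow> 's \<Rightarrow> (nat \<Rightarrow> nat) \<Rightarrow> bool" where
  "refuter_wins 0 w s h \<longleftrightarrow> False"
| "refuter_wins (Suc k) w s h \<longleftrightarrow> (\<forall>m\<in>PM. truthful w h m \<longrightarrow> (\<exists>y\<in>RM. case ruling s m y of
      Win \<Rightarrow> False | Lose \<Rightarrow> True | Again \<Rightarrow> False | Next s' \<Rightarrow> refuter_wins k w s' (move_heads w s m y h)))"

definition good_message :: "nat \<Rightarrow> 'a list \<Rightarrow> 's \<Rightarrow> (nat \<Rightarrow> nat) \<Rightarrow> 'm \<Rightarrow> bool" where
  "good_message k w s h m \<longleftrightarrow> truthful w h m \<and> (\<forall>y\<in>RM. case ruling s m y of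
      Win \<Rightarrow> True | Lose \<Rightarrow> False | Again \<Rightarrow> True | Next s' \<Rightarrow> prover_wins k w s' (move_heads w s m y h))"

definition good_reply :: "nat \<Rightarrow> 'a list \<Rightarrow> 's \<Rightarrow> (nat \<Rightarrow> nat) \<Rightarrow> 'm \<Rightarrow> 'y \<Rightarrow> bool" where
  "good_reply k w s h m y \<longleftrightarrow> (case ruling s m y of
      Win \<Rightarrow> False | Lose \<Rightarrow> True | Again \<Rightarrow> False | Next s' \<Rightarrow> refuter_wins k w s' (move_heads w s m y h))"

definition best_message :: "'a list \<Rightarrow> 's \<Rightarrow> (nat \<Rightarrow> nat) \<Rightarrow> 'm" where
  "best_message w s h = (SOME m. m \<in> PM \<and>
     ((\<exists>k. prover_wins (Suc k) w s h) \<longrightarrow> good_message (LEAST k. prover_wins (Suc k) w s h) w s h m))"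

text \<open>A lie is answered with \<open>doubt\<close>. By then a verifier that tracks a
  misreported head has already rejected, and in all other branches the round is abandoned before the
  lie can mislead the simulation.\<close>

definition best_reply :: "'a list \<Rightarrow> 's \<Rightarrow> (nat \<Rightarrow> nat) \<Rightarrow> 'm \<Rightarrow> 'y" where
  "best_reply w s h m = (if truthful w h m
     then SOME y. y \<in> RM \<and> (m \<in> PM \<and> (\<exists>k. refuter_wins (Suc k) w s h) \<longrightarrow>
       good_reply (LEAST k. refuter_wins (Suc k) w s h) w s h m y)
     else doubt)"

text \<open>Any index that witnesses a win bounds the least one, so whichever \<open>Suc k\<close>
  is known, at most \<open>k\<close> is left after the chosen message.\<close>

lemma best_message:
  shows "best_message w s h \<in> PM"
    and "prover_wins (Suc k) w s h \<Longrightarrow> \<exists>k'\<le>k. good_message k' w s h (best_message w s h)"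
proof -
  let ?l = "LEAST k. prover_wins (Suc k) w s h"
  have "\<exists>m. m \<in> PM \<and> ((\<exists>k. prover_wins (Suc k) w s h) \<longrightarrow> good_message ?l w s h m)"
  proof (cases "\<exists>k. prover_wins (Suc k) w s h")
    case True
    then obtain k where "prover_wins (Suc k) w s h" by blast
    then have "prover_wins (Suc ?l) w s h" by (rule LeastI)
    then show ?thesis unfolding good_message_def prover_wins.simps by blast
  next
    case False
    then show ?thesis using PM_nonempty by blast
  qed
  from someI_ex[OF this] have *: "best_message w s h \<in> PM"
    "(\<exists>k. prover_wins (Suc k) w s h) \<longrightarrow> good_message ?l w s h (best_message w s h)"
    unfolding best_message_def by blast+
  show "best_message w s h \<in> PM" by (rule *(1))
  assume "prover_wins (Suc k) w s h"
  then have "?l \<le> k" "good_message ?l w s h (best_message w s h)"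
    using *(2) by (auto intro: Least_le simp del: prover_wins.simps)
  then show "\<exists>k'\<le>k. good_message k' w s h (best_message w s h)" by blast
qed

lemma best_reply:
  shows "best_reply w s h m \<in> RM"
    and "\<not> truthful w h m \<Longrightarrow> best_reply w s h m = doubt"
    and "refuter_wins (Suc k) w s h \<Longrightarrow> m \<in> PM \<Longrightarrow> truthful w h m \<Longrightarrow> \<exists>k'\<le>k. good_reply k' w s h m (best_reply w s h m)"
proof -
  let ?l = "LEAST k. refuter_wins (Suc k) w s h"
  have "best_reply w s h m \<in> RM \<and> (truthful w h m \<longrightarrow> m \<in> PM \<and> (\<exists>k. refuter_wins (Suc k) w s h) \<longrightarrow>
      good_reply ?l w s h m (best_reply w s h m))"
  proof (cases "truthful w h m")
    case t: True
    have "\<exists>y. y \<in> RM \<and> (m \<in> PM \<and> (\<exists>k. refuter_wins (Suc k) w s h) \<longrightarrow> good_reply ?l w s h m y)"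
    proof (cases "m \<in> PM \<and> (\<exists>k. refuter_wins (Suc k) w s h)")
      case True
      then obtain k where "refuter_wins (Suc k) w s h" by blast
      then have "refuter_wins (Suc ?l) w s h" by (rule LeastI)
      then show ?thesis using True t unfolding good_reply_def refuter_wins.simps by blast
    next
      case False
      then show ?thesis using doubt by blast
    qed
    from someI_ex[OF this] show ?thesis
      unfolding best_reply_def using t by simp
  qed (simp add: best_reply_def doubt)
  note * = this
  show "best_reply w s h m \<in> RM" using * by blast
  show "\<not> truthful w h m \<Longrightarrow> best_reply w s h m = doubt" by (simp add: best_reply_def)
  assume "refuter_wins (Suc k) w s h" "m \<in> PM" "truthful w h m"
  then have "?l \<le> k" "good_reply ?l w s h m (best_reply w s h m)"
    using * by (auto intro: Least_le simp del: refuter_wins.simps)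
  then show "\<exists>k'\<le>k. good_reply k' w s h m (best_reply w s h m)" by blast
qed

section \<open>Strategies that replay the debate\<close>

definition next_position :: "'a list \<Rightarrow> 'm \<Rightarrow> 'y \<Rightarrow> 's \<times> (nat \<Rightarrow> nat) \<Rightarrow> 's \<times> (nat \<Rightarrow> nat)" where
  "next_position w m y = (\<lambda>(s, h). case ruling s m y of Next s' \<Rightarrow> (s', move_heads w s m y h) | _ \<Rightarrow> (s0, initial_heads))"

text \<open>The positions of all imaginary heads follow from the public debate alone, whichever head
  is tracked privately.\<close>

primrec replay :: "'a list \<Rightarrow> (nat \<Rightarrow> nat) \<Rightarrow> nat \<Rightarrow> 's \<times> (nat \<Rightarrow> nat)" where
  "replay w d 0 = (s0, initial_heads)"
| "replay w d (Suc \<tau>) =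
     next_position w (projl (mdec (d (2 * \<tau>)))) (projr (mdec (d (2 * \<tau> + 1)))) (replay w d \<tau>)"

lemma replay_cong:
  assumes "\<And>i. i < 2 * \<tau> \<Longrightarrow> d i = d' i"
  shows "replay w d \<tau> = replay w d' \<tau>"
  using assms by (induction \<tau>) auto

text \<open>For both players \<open>length pre div 2\<close> counts the completed turns; when the
  refuter is to reply, the last symbol of the prefix is the pending message.\<close>

definition prover :: "'a strategy" where
  "prover w pre = menc (Inl (case replay w (nth pre) (length pre div 2) of (s, h) \<Rightarrow> best_message w s h))"

definition refuter :: "'a strategy" where
  "refuter w pre = menc (Inr (case replay w (nth pre) (length pre div 2) of
     (s, h) \<Rightarrow> best_reply w s h (projl (mdec (last pre)))))"

lemma prover_strategy: "prover \<in> prover_strategies \<Sigma> V"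
  by (auto simp: prover_strategies_def prover_def best_message split: prod.split)

lemma refuter_strategy: "refuter \<in> refuter_strategies \<Sigma> V"
  by (auto simp: refuter_strategies_def refuter_def best_reply split: prod.split)

lemma length_debate_prefix [simp]: "length (debate_prefix P R w n) = n"
  by (induction n) auto

lemma debate_prefix_nth: "i < n \<Longrightarrow> debate_prefix P R w n ! i = debate P R w i"
  by (induction n) (auto simp: nth_append debate_def less_Suc_eq)

lemma replay_prefix:
  "2 * \<tau> \<le> n \<Longrightarrow> replay w (nth (debate_prefix P R w n)) \<tau> = replay w (debate P R w) \<tau>"
  by (rule replay_cong) (simp add: debate_prefix_nth)

lemma debate_prover:
  assumes "replay w (debate prover R w) \<tau> = (s, h)"
  shows "debate prover R w (2 * \<tau>) = menc (Inl (best_message w s h))"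
  using assms replay_prefix[of \<tau> "2 * \<tau>" w prover R] by (simp add: debate_def prover_def)

lemma debate_refuter:
  assumes "replay w (debate P refuter w) \<tau> = (s, h)" "debate P refuter w (2 * \<tau>) = menc (Inl m)" "m \<in> PM"
  shows "debate P refuter w (2 * \<tau> + 1) = menc (Inr (best_reply w s h m))"
proof -
  have "last (debate_prefix P refuter w (2 * \<tau> + 1)) = debate P refuter w (2 * \<tau>)"
    by (simp add: debate_def)
  then show ?thesis
    using assms replay_prefix[of \<tau> "2 * \<tau> + 1" w P refuter]
    by (simp add: debate_def[of P refuter w "Suc (2 * \<tau>)"] refuter_def del: debate_prefix.simps)
qed

lemma initial_heads_le: "initial_heads i \<le> length w + 1"
  by (simp add: initial_heads_def)

lemma move_heads_le: "(\<And>i. h i \<le> length w + 1) \<Longrightarrow> move_heads w s m y h i \<le> length w + 1"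
  unfolding move_heads_def by (rule cyclic_move_le)

lemma hd_heads: "hs \<in> heads \<Longrightarrow> hd hs < K"
  by (cases hs) (auto simp: heads_def)

text \<open>Lexicographic induction on the rounds left and \<open>k\<close>: a regular turn lowers
  \<open>k\<close>, while a doubt shortens \<open>hs\<close> and starts again from
  \<open>k0\<close>. Truthful messages pass the check for every tracked head.\<close>

lemma prover_halts:
  assumes w: "w \<in> lists \<Sigma>" and R: "R \<in> refuter_strategies \<Sigma> V" and pw0: "prover_wins (Suc k0) w s0 initial_heads"
    and "hs \<in> heads" "s \<in> S" "\<And>i. h i \<le> length w + 1"
    and "replay w (debate prover R w) \<tau> = (s, h)" "prover_wins (Suc k) w s h"
  shows "halts w (debate prover R w) \<omega> (enc (PTurn hs s), h (hd hs), 2 * \<tau>, c) Acc"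
  using assms(4-)
proof (induction "(length hs, k)" arbitrary: hs k s h \<tau>
    rule: wf_induct_rule[OF wf_lex_prod[OF wf_less_than wf_less_than]])
  case (1 hs k s h \<tau>)
  let ?d = "debate prover R w" and ?m = "best_message w s h"
  obtain y where y: "y \<in> RM" "?d (2 * \<tau> + 1) = menc (Inr y)"
    using debate_odd[OF w prover_strategy R] by blast
  obtain k' where k': "k' \<le> k" "good_message k' w s h ?m" using best_message(2)[OF 1(6)] by blast
  have d: "?d (2 * \<tau>) = menc (Inl ?m)" by (rule debate_prover[OF 1(5)])
  have rep: "replay w ?d (Suc \<tau>) = next_position w ?m y (s, h)"
    using 1(5) d y best_message(1) by simp
  have good: "case ruling s ?m y of
      Win \<Rightarrow> True | Lose \<Rightarrow> False | Again \<Rightarrow> True | Next s' \<Rightarrow> prover_wins k' w s' (move_heads w s ?m y h)"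
    using k'(2) y(1) unfolding good_message_def by blast
  show ?case
  proof (rule halts_turn[OF 1(2,3) best_message(1) y(1) d y(2) 1(4)])
    show "obs ?m (hd hs) = input_tape w ! h (hd hs)"
      using k'(2) hd_heads[OF 1(2)] by (simp add: good_message_def truthful_def)
    show "case ruling s ?m y of Win \<Rightarrow> Acc = Acc | Lose \<Rightarrow> Acc = Rej
      | Again \<Rightarrow> if tl hs = [] then Acc = Acc
          else halts w ?d \<omega> (enc (PTurn (tl hs) s0), initial_heads (hd (tl hs)), 2 * \<tau> + 2, c) Acc
      | Next s' \<Rightarrow> halts w ?d \<omega> (enc (PTurn hs s'), cyclic_move (length w) (head_move s ?m y (hd hs)) (h (hd hs)), 2 * \<tau> + 2, c) Acc"
    proof (cases "ruling s ?m y")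
      case Again
      have "halts w ?d \<omega> (enc (PTurn (tl hs) s0), initial_heads (hd (tl hs)), 2 * Suc \<tau>, c) Acc" if "tl hs \<noteq> []"
      proof (rule 1(1))
        show "((length (tl hs), k0), (length hs, k)) \<in> less_than <*lex*> less_than"
          using that by (cases hs) auto
        show "replay w ?d (Suc \<tau>) = (s0, initial_heads)" using rep Again by (simp add: next_position_def)
      qed (use that 1(2) tl_heads s0 initial_heads_le pw0 in auto)
      then show ?thesis using Again by simp
    next
      case (Next s')
      then have "prover_wins k' w s' (move_heads w s ?m y h)" using good by simp
      then obtain k'' where k'': "k' = Suc k''" "prover_wins (Suc k'') w s' (move_heads w s ?m y h)" by (cases k') auto
      have "halts w ?d \<omega> (enc (PTurn hs s'), move_heads w s ?m y h (hd hs), 2 * Suc \<tau>, c) Acc"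
      proof (rule 1(1))
        show "((length hs, k''), (length hs, k)) \<in> less_than <*lex*> less_than"
          using k'(1) k''(1) by auto
        show "replay w ?d (Suc \<tau>) = (s', move_heads w s ?m y h)" using rep Next by (simp add: next_position_def)
        show "s' \<in> S" using ruling_closed[OF 1(3) best_message(1) y(1) Next] .
        show "prover_wins (Suc k'') w s' (move_heads w s ?m y h)" by (rule k''(2))
      qed (use 1(2,4) move_heads_le in auto)
      then show ?thesis using Next by (simp add: move_heads_def)
    qed (use good in auto)
  qed
qed

text \<open>The debate does not depend on the private coins, so one list \<open>tgt\<close> serves
  all \<open>hs\<close>: it names a falsely announced head for each round that ends in a doubt, and
  hitting one such target leads to rejection. The induction is the same as for the prover.\<close>

lemma refuter_halts:
  assumes w: "w \<in> lists \<Sigma>" and P: "P \<in> prover_strategies \<Sigma> V" and rw0: "refuter_wins (Suc k0) w s0 initial_heads"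
    and "0 < \<rho>" "\<rho> \<le> N" "s \<in> S" "\<And>i. h i \<le> length w + 1"
    and "replay w (debate P refuter w) \<tau> = (s, h)" "refuter_wins (Suc k) w s h"
  shows "\<exists>tgt. length tgt = \<rho> \<and> set tgt \<subseteq> {..<K} \<and>
    (\<forall>hs \<omega>. hs \<in> heads \<longrightarrow> length hs = \<rho> \<longrightarrow> \<not> list_all2 (\<noteq>) hs tgt \<longrightarrow>
       halts w (debate P refuter w) \<omega> (enc (PTurn hs s), h (hd hs), 2 * \<tau>, c) Rej)"
  using assms(4-)
proof (induction "(\<rho>, k)" arbitrary: \<rho> k s h \<tau>
    rule: wf_induct_rule[OF wf_lex_prod[OF wf_less_than wf_less_than]])
  case (1 \<rho> k s h \<tau>)
  let ?d = "debate P refuter w"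
  obtain m where m: "m \<in> PM" "?d (2 * \<tau>) = menc (Inl m)"
    using debate_even[OF w P refuter_strategy] by blast
  let ?y = "best_reply w s h m"
  have d: "?d (2 * \<tau> + 1) = menc (Inr ?y)" using debate_refuter[OF 1(6) m(2,1)] .
  have rep: "replay w ?d (Suc \<tau>) = next_position w m ?y (s, h)"
    using 1(6) d m best_reply(1) by simp
  note turn = halts_turn[OF _ 1(4) m(1) best_reply(1) m(2) d 1(5)]
  note lie = halts_mismatch[OF _ 1(4) m(1), where d = ?d and j = "2 * \<tau>", OF _ m(2)]
  show ?case
  proof (cases "truthful w h m")
    case False
    then obtain i where i: "i < K" "obs m i \<noteq> input_tape w ! h i" unfolding truthful_def by blast
    have again: "ruling s m ?y = Again" using best_reply(2)[OF False] ruling_doubt by simp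
    \<comment> \<open>In the last round a doubt would lead to acceptance, so head \<open>i\<close>
      itself must be hit; in earlier rounds the later targets offer further chances.\<close>
    show ?thesis
    proof (cases "\<rho> = 1")
      case True
      show ?thesis
      proof (intro exI[of _ "[i]"] conjI allI impI)
        fix hs \<omega> assume hs: "hs \<in> heads" "length hs = \<rho>" "\<not> list_all2 (\<noteq>) hs [i]"
        then have "hd hs = i" using True by (cases hs) auto
        then show "halts w ?d \<omega> (enc (PTurn hs s), h (hd hs), 2 * \<tau>, c) Rej"
          using i hs by (intro lie) auto
      qed (use i True in auto)
    next
      case False
      have "\<exists>tgt. length tgt = \<rho> - 1 \<and> set tgt \<subseteq> {..<K} \<and>
        (\<forall>hs \<omega>. hs \<in> heads \<longrightarrow> length hs = \<rho> - 1 \<longrightarrow> \<not> list_all2 (\<noteq>) hs tgt \<longrightarrow>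
           halts w ?d \<omega> (enc (PTurn hs s0), initial_heads (hd hs), 2 * Suc \<tau>, c) Rej)"
      proof (rule 1(1))
        show "((\<rho> - 1, k0), (\<rho>, k)) \<in> less_than <*lex*> less_than" using 1(2) by auto
        show "replay w ?d (Suc \<tau>) = (s0, initial_heads)" using rep again by (simp add: next_position_def)
      qed (use False 1(2,3) s0 initial_heads_le rw0 in auto)
      then obtain tgt where tgt: "length tgt = \<rho> - 1" "set tgt \<subseteq> {..<K}"
        "\<And>hs \<omega>. \<lbrakk>hs \<in> heads; length hs = \<rho> - 1; \<not> list_all2 (\<noteq>) hs tgt\<rbrakk> \<Longrightarrow>
           halts w ?d \<omega> (enc (PTurn hs s0), initial_heads (hd hs), 2 * Suc \<tau>, c) Rej" by blast
      show ?thesis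
      proof (intro exI[of _ "i # tgt"] conjI allI impI)
        fix hs \<omega> assume hs: "hs \<in> heads" "length hs = \<rho>" "\<not> list_all2 (\<noteq>) hs (i # tgt)"
        show "halts w ?d \<omega> (enc (PTurn hs s), h (hd hs), 2 * \<tau>, c) Rej"
        proof (cases "obs m (hd hs) = input_tape w ! h (hd hs)")
          case True
          \<comment> \<open>Head \<open>i\<close> is missed in this round, so the hit lies in the
            tail of the list, which the next round uses.\<close>
          then have "hd hs \<noteq> i" using i by auto
          obtain x hs' where x: "hs = x # hs'" using hs(1) by (cases hs) (auto simp: heads_def)
          then have l: "\<not> list_all2 (\<noteq>) hs' tgt" using hs(3) \<open>hd hs \<noteq> i\<close> by auto
          have ne: "hs' \<noteq> []" using hs(2) x False by auto
          have "halts w ?d \<omega> (enc (PTurn hs' s0), initial_heads (hd hs'), 2 * Suc \<tau>, c) Rej"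
            using tl_heads[OF hs(1)] ne x hs(2) l by (intro tgt(3)) auto
          then show ?thesis
            using x ne by (intro turn[OF hs(1) True]) (simp add: again)
        next
          case False
          then show ?thesis by (intro lie hs)
        qed
      qed (use tgt i 1(2) in auto)
    qed
  next
    case True
    then have obs: "obs m (hd hs) = input_tape w ! h (hd hs)" if "hs \<in> heads" for hs
      using hd_heads[OF that] by (simp add: truthful_def)
    obtain k' where k': "k' \<le> k" "good_reply k' w s h m ?y"
      using best_reply(3)[OF 1(7) m(1) True] by blast
    show ?thesis
    proof (cases "ruling s m ?y")
      case Lose
      \<comment> \<open>The verifier rejects whatever head it tracks, so any targets serve;
        \<open>0\<close> is a head because \<open>K\<close> is positive.\<close>
      show ?thesis
        by (intro exI[of _ "replicate \<rho> 0"] conjI allI impI turn obs) (auto simp: Lose K_pos)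
    next
      case (Next s')
      then have "refuter_wins k' w s' (move_heads w s m ?y h)" using k'(2) by (simp add: good_reply_def)
      then obtain k'' where k'': "k' = Suc k''" "refuter_wins (Suc k'') w s' (move_heads w s m ?y h)" by (cases k') auto
      have "\<exists>tgt. length tgt = \<rho> \<and> set tgt \<subseteq> {..<K} \<and>
        (\<forall>hs \<omega>. hs \<in> heads \<longrightarrow> length hs = \<rho> \<longrightarrow> \<not> list_all2 (\<noteq>) hs tgt \<longrightarrow>
           halts w ?d \<omega> (enc (PTurn hs s'), move_heads w s m ?y h (hd hs), 2 * Suc \<tau>, c) Rej)"
      proof (rule 1(1))
        show "((\<rho>, k''), (\<rho>, k)) \<in> less_than <*lex*> less_than"
          using k'(1) k''(1) by auto
        show "replay w ?d (Suc \<tau>) = (s', move_heads w s m ?y h)" using rep Next by (simp add: next_position_def)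
        show "s' \<in> S" using ruling_closed[OF 1(4) m(1) best_reply(1) Next] .
        show "refuter_wins (Suc k'') w s' (move_heads w s m ?y h)" by (rule k''(2))
      qed (use 1(2,3,5) move_heads_le in auto)
      then obtain tgt where tgt: "length tgt = \<rho>" "set tgt \<subseteq> {..<K}"
        "\<And>hs \<omega>. \<lbrakk>hs \<in> heads; length hs = \<rho>; \<not> list_all2 (\<noteq>) hs tgt\<rbrakk> \<Longrightarrow>
           halts w ?d \<omega> (enc (PTurn hs s'), move_heads w s m ?y h (hd hs), 2 * Suc \<tau>, c) Rej" by blast
      show ?thesis
      proof (intro exI[of _ tgt] conjI allI impI)
        fix hs \<omega> assume hs: "hs \<in> heads" "length hs = \<rho>" "\<not> list_all2 (\<noteq>) hs tgt"
        show "halts w ?d \<omega> (enc (PTurn hs s), h (hd hs), 2 * \<tau>, c) Rej"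
          using tgt(3)[OF hs] by (intro turn[OF hs(1) obs[OF hs(1)]]) (simp add: Next move_heads_def)
      qed (use tgt in auto)
    qed (use k'(2) in \<open>auto simp: good_reply_def\<close>)
  qed
qed

section \<open>Completeness and soundness of the protocol\<close>

lemma completeness:
  assumes "w \<in> lists \<Sigma>" "\<exists>k. prover_wins k w s0 initial_heads"
  shows "\<exists>P\<in>prover_strategies \<Sigma> V. \<forall>R\<in>refuter_strategies \<Sigma> V. acc_prob V P R w = 1"
proof (intro bexI[OF _ prover_strategy] ballI)
  fix R assume R: "R \<in> refuter_strategies \<Sigma> V"
  obtain k0 where k0: "prover_wins (Suc k0) w s0 initial_heads" using assms(2) by (metis not0_implies_Suc prover_wins.simps(1))
  \<comment> \<open>Acceptance holds for every coin sequence, so the accepting event is the whole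
    space.\<close>
  have "halts w (debate prover R w) \<omega> (start V, 0, 0, 0) Acc" for \<omega>
  proof (rule halts_start[OF refl])
    have "halts w (debate prover R w) \<omega> (enc (PTurn (chosen_heads K N (map \<omega> [0..<N * K])) s0),
      initial_heads (hd (chosen_heads K N (map \<omega> [0..<N * K]))), 2 * 0, N * K) Acc"
      by (rule prover_halts[OF assms(1) R k0 chosen_heads_in_heads s0 initial_heads_le _ k0]) simp
    then show "halts w (debate prover R w) \<omega> (enc (PTurn (chosen_heads K N (map \<omega> [0..<N * K])) s0),
      initial_heads (hd (chosen_heads K N (map \<omega> [0..<N * K]))), 0, N * K) Acc" by simp
  qed
  then have "{\<omega>. \<exists>t. config_state (verifier_run V prover R w \<omega> t) = accept V} = space fair_coins"
    by (auto simp: halts_def verifier_run_def)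
  then show "acc_prob V prover R w = 1"
    unfolding acc_prob_def using prob_space.prob_space[OF prob_space_fair_coins] by simp
qed

text \<open>Every coin word whose chosen heads hit some target leads to rejection, and at most
  \<open>(2 ^ K - 1) ^ N\<close> of the \<open>(2 ^ K) ^ N\<close> words miss all targets.\<close>

lemma soundness:
  assumes "w \<in> lists \<Sigma>" "\<exists>k. refuter_wins k w s0 initial_heads"
  shows "\<forall>P\<in>prover_strategies \<Sigma> V. \<exists>R\<in>refuter_strategies \<Sigma> V. rej_prob V P R w \<ge> 1 - (1 - 1 / 2 ^ K) ^ N"
proof (intro ballI bexI[OF _ refuter_strategy])
  fix P assume P: "P \<in> prover_strategies \<Sigma> V"
  obtain k0 where k0: "refuter_wins (Suc k0) w s0 initial_heads" using assms(2) by (metis not0_implies_Suc refuter_wins.simps(1))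
  let ?d = "debate P refuter w" and ?c = "N * K"
  have "\<exists>tgt. length tgt = N \<and> set tgt \<subseteq> {..<K} \<and>
    (\<forall>hs \<omega>. hs \<in> heads \<longrightarrow> length hs = N \<longrightarrow> \<not> list_all2 (\<noteq>) hs tgt \<longrightarrow>
       halts w ?d \<omega> (enc (PTurn hs s0), initial_heads (hd hs), 2 * 0, ?c) Rej)"
    by (rule refuter_halts[OF assms(1) P k0 N_pos order_refl s0 initial_heads_le _ k0]) simp
  then obtain tgt where tgt: "length tgt = N" "set tgt \<subseteq> {..<K}"
    "\<And>hs \<omega>. \<lbrakk>hs \<in> heads; length hs = N; \<not> list_all2 (\<noteq>) hs tgt\<rbrakk> \<Longrightarrow>
       halts w ?d \<omega> (enc (PTurn hs s0), initial_heads (hd hs), 0, ?c) Rej" by auto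
  \<comment> \<open>Extending the word \<open>u\<close> by whatever \<open>nth\<close> yields past
    its end is harmless, since only the first \<open>N * K\<close> coins are read.\<close>
  define Q where "Q u = halts w ?d (nth u) (start V, 0, 0, 0) Rej" for u
  have hit: "Q u" if "length u = ?c" "\<not> list_all2 (\<noteq>) (chosen_heads K N u) tgt" for u
    unfolding Q_def
  proof (rule halts_start)
    show "chosen_heads K N u = chosen_heads K N (map (nth u) [0..<?c])" using that(1) by (metis map_nth)
  qed (use that tgt(3) chosen_heads_in_heads in auto)
  have "halts w ?d \<omega> (start V, 0, 0, 0) Rej \<longleftrightarrow> Q (map \<omega> [0..<?c])" for \<omega>
    unfolding Q_def halts_def
    using run_agree[OF debate_ok[OF assms(1) P refuter_strategy], of \<omega> "nth (map \<omega> [0..<?c])"] by simp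
  then have "rej_prob V P refuter w = measure fair_coins {\<omega>. Q (map \<omega> [0..<?c])}"
    by (simp add: rej_prob_def halts_def verifier_run_def)
  also have "\<dots> = card {u. length u = ?c \<and> Q u} / 2 ^ ?c" by (rule fair_coins_prefix)
  finally have rej: "rej_prob V P refuter w = card {u. length u = ?c \<and> Q u} / 2 ^ ?c" .
  let ?B = "{u. length u = ?c \<and> list_all2 (\<noteq>) (chosen_heads K N u) tgt}"
  have "{u. length u = ?c} \<subseteq> {u. length u = ?c \<and> Q u} \<union> ?B" using hit by auto
  then have "card {u :: bool list. length u = ?c} \<le> card ({u. length u = ?c \<and> Q u} \<union> ?B)"
    by (intro card_mono finite_UnI finite_bool_lists)
  also have "\<dots> \<le> card {u. length u = ?c \<and> Q u} + card ?B" by (rule card_Un_le)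
  also have "card ?B \<le> (2 ^ K - 1) ^ N" by (rule card_chosen_heads_miss[OF K_pos tgt(1,2)])
  finally have "(2::nat) ^ ?c \<le> card {u. length u = ?c \<and> Q u} + (2 ^ K - 1) ^ N"
    by (simp add: card_bool_lists)
  then have "real (2 ^ ?c) \<le> real (card {u. length u = ?c \<and> Q u} + (2 ^ K - 1) ^ N)"
    by (rule of_nat_mono)
  then have "2 ^ ?c - (2 ^ K - 1) ^ N \<le> real (card {u. length u = ?c \<and> Q u})"
    by (simp add: of_nat_diff)
  then have "(2 ^ ?c - (2 ^ K - 1) ^ N) / 2 ^ ?c \<le> rej_prob V P refuter w"
    unfolding rej by (intro divide_right_mono) auto
  also have "((2::real) ^ ?c - (2 ^ K - 1) ^ N) / 2 ^ ?c = 1 - (2 ^ K - 1) ^ N / (2 ^ K) ^ N"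
    by (subst diff_divide_distrib) (simp add: power_mult[symmetric] mult.commute)
  also have "\<dots> = 1 - (1 - 1 / 2 ^ K) ^ N"
    by (simp add: power_divide[symmetric] diff_divide_distrib)
  finally show "rej_prob V P refuter w \<ge> 1 - (1 - 1 / 2 ^ K) ^ N" .
qed

end

section \<open>The debate about a Turing machine\<close>

text \<open>\<open>Fwd q\<close> asserts the current state, \<open>Bwd c\<close> the contents of the
  current cell together with the machine state if the machine's head is there. The time and the cell
  are stored by the imaginary heads, so a claim carries finite information only.\<close>

datatype 'a cell_claim = Fwd nat | Bwd "'a tape_symbol \<times> nat option"

text \<open>In the forward phase any \<open>Pick\<close> lets the announcement stand; in the
  backward phase \<open>Pick d\<close> selects the neighbour to be defended next.\<close>

datatype reply = Doubt | Challenge | Pick dir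

section \<open>Digits in base \<open>n + 2\<close> as positions on the input tape\<close>

definition digit :: "nat \<Rightarrow> int \<Rightarrow> nat \<Rightarrow> int" where
  "digit n v j = v div (int n + 2) ^ j mod (int n + 2)"

lemma digit_bounds: "0 \<le> digit n v j" "digit n v j \<le> int n + 1"
proof -
  have "digit n v j < int n + 2" unfolding digit_def by (rule pos_mod_bound) simp
  then show "digit n v j \<le> int n + 1" by simp
qed (simp add: digit_def)

lemma digit_succ:
  "digit n (v + 1) j = (if \<forall>i<j. digit n v i = int n + 1
     then if digit n v j = int n + 1 then 0 else digit n v j + 1 else digit n v j)"
proof (cases "\<forall>i<j. digit n v i = int n + 1")
  case True
  define x where "x = v div (int n + 2) ^ j"
  have "(v + 1) div (int n + 2) ^ j = x + 1"
    unfolding x_def using True by (subst succ_div_power) (auto simp: digit_def)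
  moreover have "(x + 1) mod (int n + 2) = (if x mod (int n + 2) = int n + 1 then 0 else x mod (int n + 2) + 1)"
    by (smt (verit) mod_add_left_eq mod_pos_pos_trivial mod_self of_nat_0_le_iff pos_mod_bound pos_mod_sign)
  ultimately show ?thesis using True by (simp add: digit_def x_def)
next
  case False
  have "(v + 1) div (int n + 2) ^ j = v div (int n + 2) ^ j"
    using False by (subst succ_div_power) (auto simp: digit_def)
  then show ?thesis using False by (simp add: digit_def)
qed

lemma digit_pred:
  "digit n (v - 1) j = (if \<forall>i<j. digit n v i = 0
     then if digit n v j = 0 then int n + 1 else digit n v j - 1 else digit n v j)"
proof (cases "\<forall>i<j. digit n v i = 0")
  case True
  define x where "x = v div (int n + 2) ^ j"
  have "(v - 1) div (int n + 2) ^ j = x - 1"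
    unfolding x_def using True by (subst pred_div_power) (auto simp: digit_def)
  moreover have "(x - 1) mod (int n + 2) = (if x mod (int n + 2) = 0 then int n + 1 else x mod (int n + 2) - 1)"
    by (smt (verit) mod_diff_left_eq mod_pos_pos_trivial minus_mod_self1 mod_add_self2 of_nat_0_le_iff pos_mod_bound pos_mod_sign)
  ultimately show ?thesis using True by (simp add: digit_def x_def)
next
  case False
  have "(v - 1) div (int n + 2) ^ j = v div (int n + 2) ^ j"
    using False by (subst pred_div_power) (auto simp: digit_def)
  then show ?thesis using False by (simp add: digit_def)
qed

definition carry :: "nat \<Rightarrow> dir \<Rightarrow> int \<Rightarrow> nat \<Rightarrow> dir" where
  "carry n d v j = (case d of
       MoveL \<Rightarrow> if \<forall>i<j. digit n v i = 0 then MoveL else Stay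
     | Stay \<Rightarrow> Stay
     | MoveR \<Rightarrow> if \<forall>i<j. digit n v i = int n + 1 then MoveR else Stay)"

text \<open>A carry turns \<open>n + 1\<close> into \<open>0\<close> and a borrow turns
  \<open>0\<close> into \<open>n + 1\<close>, which is the wraparound of a cyclic head. Negative
  numbers need no separate treatment, as their digits are those of the complement.\<close>

lemma digit_move: "nat (digit n (move d v) j) = cyclic_move n (carry n d v j) (nat (digit n v j))"
proof (cases d)
  case MoveL
  then show ?thesis using digit_bounds[of n v j] by (auto simp: carry_def cyclic_move_def digit_pred nat_eq_iff)
next
  case MoveR
  then show ?thesis using digit_bounds[of n v j] by (auto simp: carry_def cyclic_move_def digit_succ nat_eq_iff)
qed (simp add: carry_def cyclic_move_def)

text \<open>Here \<open>m\<close> is the number of digits of each counter.\<close>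

locale tm_protocol =
  fixes \<Sigma> :: "'a set" and M :: "'a tm" and m N :: nat
  assumes finite_\<Sigma>: "finite \<Sigma>" and wf_M: "wf_tm \<Sigma> M" and m_pos: "m > 0" and N_pos: "N > 0"
begin

section \<open>The local rule of the Turing machine\<close>

definition halting :: "nat \<Rightarrow> bool" where
  "halting q \<longleftrightarrow> q = tm_accept M \<or> q = tm_reject M"

text \<open>Halting becomes a stationary transition that rewrites the scanned symbol, so that one
  local rule also covers halted configurations.\<close>

definition hdelta :: "nat \<Rightarrow> 'a tape_symbol \<Rightarrow> nat \<times> 'a tape_symbol \<times> dir" where
  "hdelta q a = (if halting q then (q, a, Stay) else tm_delta M q a)"

lemma tm_step_hdelta:
  "tm_step M (q, tape, p) = (case hdelta q (tape p) of (q', a, d) \<Rightarrow> (q', tape(p := a), move d p))"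
  by (auto simp: hdelta_def halting_def)

definition cells :: "('a tape_symbol \<times> nat option) set" where
  "cells = tm_symbols M \<times> insert None (Some ` tm_states M)"

definition cell :: "'a tm_config \<Rightarrow> int \<Rightarrow> 'a tape_symbol \<times> nat option" where
  "cell = (\<lambda>(q, tape, pos) p. (tape p, if pos = p then Some q else None))"

definition written :: "'a tape_symbol \<times> nat option \<Rightarrow> 'a tape_symbol" where
  "written c = (case snd c of None \<Rightarrow> fst c | Some q \<Rightarrow> fst (snd (hdelta q (fst c))))"

definition arrival :: "dir \<Rightarrow> 'a tape_symbol \<times> nat option \<Rightarrow> nat option" where
  "arrival d c = (case snd c of None \<Rightarrow> None
     | Some q \<Rightarrow> case hdelta q (fst c) of (q', _, d') \<Rightarrow> if d' = d then Some q' else None)"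

text \<open>In a true configuration at most one of the three cells holds the head, so the order of
  the alternatives matters only for false triples.\<close>

definition next_cell :: "(dir \<Rightarrow> 'a tape_symbol \<times> nat option) \<Rightarrow> 'a tape_symbol \<times> nat option" where
  "next_cell f = (written (f Stay),
     if arrival MoveR (f MoveL) \<noteq> None then arrival MoveR (f MoveL)
     else if arrival Stay (f Stay) \<noteq> None then arrival Stay (f Stay)
     else arrival MoveL (f MoveR))"

text \<open>The machine acts locally, which is why a claim about one cell can be traced back to
  three claims one step earlier.\<close>

lemma cell_step: "cell (tm_step M cfg) p = next_cell (\<lambda>d. cell cfg (move d p))"
proof -
  obtain q tape pos where cfg: "cfg = (q, tape, pos)" by (cases cfg) auto
  obtain q' a d where h: "hdelta q (tape pos) = (q', a, d)" by (cases "hdelta q (tape pos)") auto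
  have s: "tm_step M cfg = (q', tape(pos := a), move d pos)"
    unfolding cfg tm_step_hdelta h by simp
  have q: "cell (tm_step M cfg) r = (if r = pos then a else tape r, if move d pos = r then Some q' else None)" for r
    unfolding s by (simp add: cell_def)
  have c: "cell cfg r = (tape r, if pos = r then Some q else None)" for r
    unfolding cfg by (simp add: cell_def)
  consider "p = pos + 1" | "p = pos" | "p = pos - 1" | "p \<noteq> pos + 1" "p \<noteq> pos" "p \<noteq> pos - 1" by blast
  then show ?thesis
  proof cases
    case 4
    then have "pos \<noteq> p - 1" "pos \<noteq> p" "pos \<noteq> p + 1" by auto
    with 4 show ?thesis
      unfolding q c next_cell_def written_def arrival_def by (cases d) simp_all
  qed (unfold q c next_cell_def written_def arrival_def, (cases d; simp add: h)+)
qed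

definition conf :: "'a list \<Rightarrow> nat \<Rightarrow> 'a tm_config" where
  "conf w t = (tm_step M ^^ t) (tm_init M w)"

lemma conf_Suc: "conf w (Suc t) = tm_step M (conf w t)"
  by (simp add: conf_def)

lemma conf_ok:
  assumes "w \<in> lists \<Sigma>" "conf w t = (q, tape, p)"
  shows "q \<in> tm_states M \<and> range tape \<subseteq> tm_symbols M \<and> \<bar>p\<bar> \<le> int t"
  using assms(2)
proof (induction t arbitrary: q tape p)
  case 0
  have "Input (w ! nat i) \<in> tm_symbols M" if "0 \<le> i" "i < int (length w)" for i
  proof -
    have "w ! nat i \<in> set w" using that by (intro nth_mem) auto
    then show ?thesis using assms(1) wf_M unfolding wf_tm_def by blast
  qed
  then show ?case using 0 wf_M by (auto simp: conf_def tm_init_def wf_tm_def)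
next
  case (Suc t)
  obtain q0 tape0 p0 where c: "conf w t = (q0, tape0, p0)" by (cases "conf w t") auto
  note IH = Suc.IH[OF c]
  obtain q' a d where h: "hdelta q0 (tape0 p0) = (q', a, d)" by (cases "hdelta q0 (tape0 p0)") auto
  have "q' \<in> tm_states M \<and> a \<in> tm_symbols M"
  proof (cases "halting q0")
    case True
    then show ?thesis using h IH by (auto simp: hdelta_def)
  next
    case False
    then have "tm_delta M q0 (tape0 p0) \<in> tm_states M \<times> tm_symbols M \<times> UNIV"
      using IH wf_M unfolding wf_tm_def halting_def by blast
    then show ?thesis using h False by (simp add: hdelta_def)
  qed
  moreover have "q = q'" "tape = tape0(p0 := a)" "p = move d p0"
    using Suc.prems unfolding conf_Suc c tm_step_hdelta h by auto
  ultimately show ?case using IH by (cases d) auto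
qed

lemma cell_conf: "w \<in> lists \<Sigma> \<Longrightarrow> cell (conf w t) p \<in> cells"
  using conf_ok[of w t] by (cases "conf w t") (auto simp: cell_def cells_def)

lemma conf_halted:
  assumes "halting (fst (conf w t))" "t \<le> T"
  shows "conf w T = conf w t"
  using assms(2)
proof (induction T rule: dec_induct)
  case (step T)
  then show ?case using assms(1) by (cases "conf w t") (auto simp: conf_Suc halting_def)
qed simp

text \<open>The heads come in three groups of \<open>m\<close>, the digits of the time \<open>t\<close>, of the cell
  \<open>p\<close> and of \<open>p + 1\<close>. The second group tests whether \<open>p = 0\<close>; the third one scans the input
  symbol of cell \<open>p\<close>, since the endmarker shifts the input by one.\<close>

definition counter :: "nat \<Rightarrow> int \<Rightarrow> nat \<Rightarrow> int" where
  "counter t p g = (if g = 0 then int t else if g = 1 then p else p + 1)"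

definition heads_at :: "'a list \<Rightarrow> (nat \<Rightarrow> nat) \<Rightarrow> nat \<Rightarrow> int \<Rightarrow> bool" where
  "heads_at w h t p \<longleftrightarrow>
     (\<forall>g<3. \<forall>j<m. h (g * m + j) = nat (digit (length w) (counter t p g) j))"

section \<open>Messages and rules of the debate\<close>

type_synonym 'b message = "'b input_symbol list \<times> (dir \<Rightarrow> 'b tape_symbol \<times> nat option)"

text \<open>A head on the left endmarker represents the digit \<open>0\<close>.\<close>

definition all_left :: "'a input_symbol list \<Rightarrow> nat \<Rightarrow> bool" where
  "all_left xs g \<longleftrightarrow> (\<forall>j<m. xs ! (g * m + j) = LeftEnd)"

text \<open>If the higher digits of \<open>p + 1\<close> vanish, then \<open>p + 1\<close> is itself
  a position on the input tape and the lowest digit scans the symbol of cell \<open>p\<close>. Both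
  endmarkers stand for blank cells next to the input.\<close>

definition init_symbol :: "'a input_symbol list \<Rightarrow> 'a tape_symbol" where
  "init_symbol xs = (if \<forall>j. 0 < j \<and> j < m \<longrightarrow> xs ! (2 * m + j) = LeftEnd
     then case xs ! (2 * m + 0) of Sym a \<Rightarrow> Input a | _ \<Rightarrow> Blank else Blank)"

definition init_cell :: "'a input_symbol list \<Rightarrow> 'a tape_symbol \<times> nat option" where
  "init_cell xs = (init_symbol xs, if all_left xs 1 then Some (tm_start M) else None)"

text \<open>In the backward phase a challenge counts as picking the cell itself.\<close>

definition pick_dir :: "reply \<Rightarrow> dir" where
  "pick_dir y = (case y of Pick d \<Rightarrow> d | _ \<Rightarrow> Stay)"

text \<open>\<open>Doubt\<close> is tested first, so it never harms the prover by itself. A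
  challenge turns the announced symbol and the current state into a claim about the scanned cell. In
  the backward phase a triple that does not support the claim loses at once; at time
  \<open>0\<close> the claim is compared with the announced input.\<close>

definition judge :: "'a cell_claim \<Rightarrow> 'a message \<Rightarrow> reply \<Rightarrow> 'a cell_claim outcome" where
  "judge s msg y = (case msg of (xs, f) \<Rightarrow>
     if y = Doubt then Again else case s of
       Fwd q \<Rightarrow>
         if q = tm_accept M then Win else if q = tm_reject M then Lose
         else if y = Challenge then Next (Bwd (fst (f Stay), Some q))
         else Next (Fwd (fst (tm_delta M q (fst (f Stay)))))
     | Bwd c \<Rightarrow>
         if all_left xs 0 then if c = init_cell xs then Win else Lose
         else if next_cell f = c then Next (Bwd (f (pick_dir y))) else Lose)"

definition time_dir :: "'a cell_claim \<Rightarrow> reply \<Rightarrow> dir" where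
  "time_dir s y = (case s of Fwd q \<Rightarrow> if y = Challenge then Stay else MoveR | Bwd c \<Rightarrow> MoveL)"

definition cell_dir :: "'a cell_claim \<Rightarrow> 'a message \<Rightarrow> reply \<Rightarrow> dir" where
  "cell_dir s msg y = (case s of
       Fwd q \<Rightarrow> if y = Challenge then Stay else snd (snd (tm_delta M q (fst (snd msg Stay))))
     | Bwd c \<Rightarrow> pick_dir y)"

text \<open>The counterpart of \<open>carry\<close> that is computable from a message:
  \<open>LeftEnd\<close> reveals a digit \<open>0\<close> and \<open>RightEnd\<close> a digit
  \<open>n + 1\<close>.\<close>

definition carry_dir :: "'a input_symbol list \<Rightarrow> dir \<Rightarrow> nat \<Rightarrow> nat \<Rightarrow> dir" where
  "carry_dir xs d g j = (case d of
       MoveL \<Rightarrow> if \<forall>i<j. xs ! (g * m + i) = LeftEnd then MoveL else Stay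
     | Stay \<Rightarrow> Stay
     | MoveR \<Rightarrow> if \<forall>i<j. xs ! (g * m + i) = RightEnd then MoveR else Stay)"

definition head_dir :: "'a cell_claim \<Rightarrow> 'a message \<Rightarrow> reply \<Rightarrow> nat \<Rightarrow> dir" where
  "head_dir s msg y i =
     carry_dir (fst msg) (if i div m = 0 then time_dir s y else cell_dir s msg y) (i div m) (i mod m)"

definition input_symbols :: "'a input_symbol set" where
  "input_symbols = {LeftEnd, RightEnd} \<union> Sym ` \<Sigma>"

definition messages :: "'a message set" where
  "messages = {xs. set xs \<subseteq> input_symbols \<and> length xs = 3 * m} \<times> (UNIV \<rightarrow>\<^sub>E cells)"

definition claims :: "'a cell_claim set" where
  "claims = Fwd ` tm_states M \<union> Bwd ` cells"

lemma dir_UNIV: "(UNIV :: dir set) = {MoveL, Stay, MoveR}"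
  using dir.exhaust by auto

lemma reply_UNIV: "(UNIV :: reply set) = {Doubt, Challenge} \<union> Pick ` UNIV"
  using reply.exhaust by auto

lemma finite_cells: "finite cells"
  using wf_M by (simp add: cells_def wf_tm_def)

text \<open>Head \<open>2 * m\<close> is the lowest digit of \<open>p + 1\<close>, which equals
  \<open>1\<close> because the machine starts in cell \<open>0\<close>; all other digits start as
  \<open>0\<close>.\<close>

sublocale protocol \<Sigma> "3 * m" N claims messages UNIV "Fwd (tm_start M)" "\<lambda>i. i = 2 * m"
  "\<lambda>msg i. fst msg ! i" judge head_dir Doubt
proof
  show "finite claims" using finite_cells wf_M by (simp add: claims_def wf_tm_def)
  have "finite input_symbols" using finite_\<Sigma> by (simp add: input_symbols_def)
  moreover have "finite ((UNIV :: dir set) \<rightarrow>\<^sub>E cells)"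
    by (rule finite_PiE) (simp_all add: dir_UNIV finite_cells)
  ultimately show "finite messages"
    unfolding messages_def by (intro finite_cartesian_product finite_lists_length_eq)
  show "finite (UNIV :: reply set)" unfolding reply_UNIV by (simp add: dir_UNIV)
  have "(Blank, None) \<in> cells" using wf_M by (auto simp: cells_def wf_tm_def)
  then have "(replicate (3 * m) LeftEnd, \<lambda>_. (Blank, None)) \<in> messages"
    by (auto simp: messages_def input_symbols_def)
  then show "messages \<noteq> {}" by blast
  show "Fwd (tm_start M) \<in> claims" using wf_M by (auto simp: claims_def wf_tm_def)
  fix s msg y s' assume "s \<in> claims" "msg \<in> messages" "judge s msg y = Next s'"
  then show "s' \<in> claims"
  proof (cases s)
    case (Fwd q)
    obtain xs f where f: "msg = (xs, f)" by (cases msg)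
    then have c: "f Stay \<in> cells" "q \<in> tm_states M"
      using \<open>msg \<in> messages\<close> \<open>s \<in> claims\<close> Fwd by (auto simp: messages_def claims_def)
    then have a: "fst (f Stay) \<in> tm_symbols M" by (auto simp: cells_def)
    have "fst (tm_delta M q (fst (f Stay))) \<in> tm_states M" if "q \<noteq> tm_accept M" "q \<noteq> tm_reject M"
    proof -
      have "tm_delta M q (fst (f Stay)) \<in> tm_states M \<times> tm_symbols M \<times> UNIV"
        using wf_M a c that unfolding wf_tm_def by blast
      then show ?thesis by auto
    qed
    then show ?thesis
      using \<open>judge s msg y = Next s'\<close> a c
      by (auto simp: judge_def Fwd f claims_def cells_def split: if_splits)
  next
    case (Bwd c)
    then show ?thesis
      using \<open>judge s msg y = Next s'\<close> \<open>msg \<in> messages\<close>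
      by (auto simp: judge_def claims_def messages_def split: if_splits prod.splits)
  qed
qed (use m_pos N_pos in \<open>auto simp: judge_def split: prod.split\<close>)

lemma group_lt: "g < 3 \<Longrightarrow> j < m \<Longrightarrow> g * m + j < 3 * m"
proof -
  assume "g < 3" "j < m"
  then have "g * m + j < (g + 1) * m" by simp
  also have "\<dots> \<le> 3 * m" using \<open>g < 3\<close> by (intro mult_right_mono) auto
  finally show ?thesis .
qed

lemma truthful_symbols:
  assumes "truthful w h (xs, f)" "heads_at w h t p" "g < 3" "j < m"
  shows "xs ! (g * m + j) = input_tape w ! nat (digit (length w) (counter t p g) j)"
    and "xs ! (g * m + j) = LeftEnd \<longleftrightarrow> digit (length w) (counter t p g) j = 0"
    and "xs ! (g * m + j) = RightEnd \<longleftrightarrow> digit (length w) (counter t p g) j = int (length w) + 1"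
proof -
  let ?v = "digit (length w) (counter t p g) j"
  show x: "xs ! (g * m + j) = input_tape w ! nat ?v"
    using assms group_lt[OF assms(3,4)] by (simp add: truthful_def heads_at_def)
  have "nat ?v \<le> length w + 1" using digit_bounds[of "length w" "counter t p g" j] by simp
  then show "xs ! (g * m + j) = LeftEnd \<longleftrightarrow> ?v = 0"
    "xs ! (g * m + j) = RightEnd \<longleftrightarrow> ?v = int (length w) + 1"
    unfolding x input_tape_LeftEnd[OF \<open>nat ?v \<le> length w + 1\<close>] input_tape_RightEnd[OF \<open>nat ?v \<le> length w + 1\<close>]
    using digit_bounds[of "length w" "counter t p g" j] by auto
qed

text \<open>The announced endmarkers are genuine, so the carries computed from the message are the
  true ones and the counters stay synchronised with \<open>t\<close> and \<open>p\<close>.\<close>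

lemma heads_at_move:
  assumes "truthful w h (xs, f)" "heads_at w h t p"
    and "int t' = move (time_dir s y) (int t)" "p' = move (cell_dir s (xs, f) y) p"
  shows "heads_at w (move_heads w s (xs, f) y h) t' p'"
  unfolding heads_at_def
proof (intro allI impI)
  fix g j :: nat assume g: "g < 3" and j: "j < m"
  let ?d = "if g = 0 then time_dir s y else cell_dir s (xs, f) y"
  have c: "counter t' p' g = move ?d (counter t p g)"
    using assms(3,4) by (cases "cell_dir s (xs, f) y") (auto simp: counter_def)
  have "head_dir s (xs, f) y (g * m + j) = carry_dir xs ?d g j"
    using j by (simp add: head_dir_def)
  also have "\<dots> = carry (length w) ?d (counter t p g) j"
    using truthful_symbols(2,3)[OF assms(1,2) g] j by (auto simp: carry_dir_def carry_def split: dir.split)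
  finally show "move_heads w s (xs, f) y h (g * m + j) = nat (digit (length w) (counter t' p' g) j)"
    using assms(2) g j by (simp add: move_heads_def c digit_move heads_at_def)
qed

lemma heads_at_initial: "heads_at w initial_heads 0 0"
  unfolding heads_at_def
proof (intro allI impI)
  fix g j :: nat assume g: "g < 3" and j: "j < m"
  have "g * m + j = 2 * m \<longleftrightarrow> g = 2 \<and> j = 0"
  proof
    assume *: "g * m + j = 2 * m"
    have "g = (g * m + j) div m" "j = (g * m + j) mod m" using j by auto
    then show "g = 2 \<and> j = 0" unfolding * using j by auto
  qed simp
  moreover have "digit (length w) 1 j = of_bool (j = 0)"
  proof (cases j)
    case (Suc j')
    have "(1::int) < (int (length w) + 2) ^ Suc j'" by (intro one_less_power) auto
    then have "(1::int) div (int (length w) + 2) ^ Suc j' = 0" by (intro div_pos_pos_trivial) linarith+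
    then show ?thesis using Suc by (simp add: digit_def)
  qed (simp add: digit_def)
  ultimately show "initial_heads (g * m + j) = nat (digit (length w) (counter 0 0 g) j)"
    using g by (auto simp: initial_heads_def counter_def) (auto simp: digit_def)
qed

definition honest :: "'a list \<Rightarrow> (nat \<Rightarrow> nat) \<Rightarrow> (dir \<Rightarrow> 'a tape_symbol \<times> nat option) \<Rightarrow> 'a message" where
  "honest w h f = (map (\<lambda>i. input_tape w ! h i) [0..<3 * m], f)"

lemma honest:
  assumes "w \<in> lists \<Sigma>" "heads_at w h t p" "\<And>d. f d \<in> cells"
  shows "honest w h f \<in> messages" "truthful w h (honest w h f)"
proof -
  have "input_tape w ! h i \<in> input_symbols" if "i < 3 * m" for i
  proof -
    have "i div m < 3" using that by (simp add: less_mult_imp_div_less)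
    then have "h (i div m * m + i mod m) = nat (digit (length w) (counter t p (i div m)) (i mod m))"
      using assms(2) mod_less_divisor[OF m_pos] unfolding heads_at_def by blast
    then have "h i \<le> length w + 1"
      using digit_bounds[of "length w" "counter t p (i div m)" "i mod m"] by simp
    then have "h i < length (input_tape w)" by (simp add: input_tape_def)
    then have "input_tape w ! h i \<in> set (input_tape w)" by (rule nth_mem)
    then show ?thesis using assms(1) by (auto simp: input_tape_def input_symbols_def)
  qed
  then show "honest w h f \<in> messages"
    using assms(3) by (auto simp: honest_def messages_def)
  show "truthful w h (honest w h f)" by (simp add: truthful_def honest_def)
qed

section \<open>Winning strategies for an input on which the machine halts within \<open>T\<close>
  steps\<close>

context
  fixes w :: "'a list" and T :: nat
  assumes w: "w \<in> lists \<Sigma>" and halted: "halting (fst (conf w T))"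
    and big: "2 * int T + int (length w) + 3 \<le> (int (length w) + 2) ^ m"
begin

lemma all_left_iff:
  assumes "truthful w h (xs, f)" "heads_at w h t p" "g < 3" "\<bar>counter t p g\<bar> < (int (length w) + 2) ^ m"
  shows "all_left xs g \<longleftrightarrow> counter t p g = 0"
  unfolding all_left_def using truthful_symbols(2)[OF assms(1-3)] digits_zero_iff[OF _ assms(4)]
  by (simp add: digit_def)

text \<open>The bound \<open>big\<close> is what the test of the high digits of \<open>p + 1\<close>
  in base \<open>length w + 2\<close> requires, as
  \<open>\<bar>p + 1\<bar> \<le> 2 * T + 1\<close>.\<close>

lemma init_cell:
  assumes "truthful w h (xs, f)" "heads_at w h t p" "\<bar>p\<bar> \<le> 2 * int T"
  shows "init_cell xs = cell (conf w 0) p"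
proof -
  let ?n = "int (length w)"
  have "all_left xs 1 \<longleftrightarrow> p = 0"
    using all_left_iff[OF assms(1,2), of 1] assms(3) big by (simp add: counter_def)
  moreover have "init_symbol xs = fst (snd (conf w 0)) p"
  proof -
    have hi: "(\<forall>j. 0 < j \<and> j < m \<longrightarrow> xs ! (2 * m + j) = LeftEnd) \<longleftrightarrow> 0 \<le> p + 1 \<and> p + 1 < ?n + 2"
      using truthful_symbols(2)[OF assms(1,2), of 2] m_pos assms(3) big
        high_digits_zero_iff[of "?n + 2" m "p + 1"]
      by (simp add: counter_def digit_def)
    have lo: "xs ! (2 * m + 0) = input_tape w ! nat ((p + 1) mod (?n + 2))"
      using truthful_symbols(1)[OF assms(1,2), of 2 0] m_pos by (simp add: counter_def digit_def)
    show ?thesis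
    proof (cases "0 \<le> p + 1 \<and> p + 1 < ?n + 2")
      case True
      then have "init_symbol xs = (case input_tape w ! nat (p + 1) of Sym a \<Rightarrow> Input a | _ \<Rightarrow> Blank)"
        unfolding init_symbol_def hi lo by simp
      also have "input_tape w ! nat (p + 1) = (if p = -1 then LeftEnd else if p = ?n then RightEnd else Sym (w ! nat p))"
        using True by (subst input_tape_nth) (auto simp: nat_add_distrib)
      finally show ?thesis using True by (auto simp: conf_def tm_init_def)
    next
      case False
      then have "init_symbol xs = Blank"
        unfolding init_symbol_def hi by (simp only: if_False)
      then show ?thesis using False by (auto simp: conf_def tm_init_def)
    qed
  qed
  ultimately show ?thesis
    by (auto simp: init_cell_def cell_def conf_def tm_init_def)
qed

lemma time_zero_iff:
  assumes "truthful w h (xs, f)" "heads_at w h t p" "t \<le> T"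
  shows "all_left xs 0 \<longleftrightarrow> t = 0"
  using all_left_iff[OF assms(1,2), of 0] assms(3) big by (simp add: counter_def)

text \<open>The prover supports a true claim by the true neighbours, so every pick leads to a true
  claim again. Each turn lowers \<open>t\<close> by one and changes \<open>p\<close> by at most one,
  which preserves the bound on \<open>\<bar>p\<bar> + t\<close>. The padding \<open>e\<close> lets
  the index be larger than the number of turns needed.\<close>

lemma prover_wins_Bwd:
  assumes "heads_at w h t p" "t \<le> T" "\<bar>p\<bar> + int t \<le> 2 * int T"
  shows "prover_wins (Suc (t + e)) w (Bwd (cell (conf w t) p)) h"
  using assms
proof (induction t arbitrary: p h)
  case 0
  let ?f = "\<lambda>_. cell (conf w 0) p"
  note msg = honest[OF w 0(1), of ?f, OF cell_conf[OF w]]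
  have j: "judge (Bwd (cell (conf w 0) p)) (honest w h ?f) y = (if y = Doubt then Again else Win)" for y
    using time_zero_iff[OF msg(2)[unfolded honest_def] 0(1)] init_cell[OF msg(2)[unfolded honest_def] 0(1)] 0(3)
    by (auto simp: judge_def honest_def)
  show ?case using msg unfolding prover_wins.simps
    by (intro bexI[of _ "honest w h ?f"] conjI ballI) (simp_all add: j)
next
  case (Suc t)
  let ?f = "\<lambda>d. cell (conf w t) (move d p)"
  let ?s = "Bwd (cell (conf w (Suc t)) p)"
  note msg = honest[OF w Suc(2), of ?f, OF cell_conf[OF w]]
  have j: "judge ?s (honest w h ?f) y = (if y = Doubt then Again else Next (Bwd (?f (pick_dir y))))" for y
    using time_zero_iff[OF msg(2)[unfolded honest_def] Suc(2,3)]
    by (simp add: judge_def honest_def conf_Suc cell_step)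
  have "prover_wins (Suc (t + e)) w (Bwd (?f (pick_dir y))) (move_heads w ?s (honest w h ?f) y h)" for y
  proof (rule Suc.IH)
    show "heads_at w (move_heads w ?s (honest w h ?f) y h) t (move (pick_dir y) p)"
      unfolding honest_def
      by (rule heads_at_move[OF msg(2)[unfolded honest_def] Suc(2)]) (simp_all add: time_dir_def cell_dir_def)
    show "\<bar>move (pick_dir y) p\<bar> + int t \<le> 2 * int T"
      using Suc(4) by (cases "pick_dir y") auto
  qed (use Suc(3) in simp)
  then show ?case using msg unfolding prover_wins.simps(2)[of "Suc t + e"]
    by (intro bexI[of _ "honest w h ?f"] conjI ballI) (simp_all add: j del: prover_wins.simps)
qed

text \<open>A triple that supports a false claim differs from the true neighbours, since those yield
  the true cell by \<open>cell_step\<close>. The refuter picks a false entry, and falsehood survives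
  down to time \<open>0\<close>.\<close>

lemma refuter_wins_Bwd:
  assumes "heads_at w h t p" "t \<le> T" "\<bar>p\<bar> + int t \<le> 2 * int T" "c \<noteq> cell (conf w t) p"
  shows "refuter_wins (Suc (t + e)) w (Bwd c) h"
  using assms
proof (induction t arbitrary: p h c)
  case 0
  have "judge (Bwd c) msg Challenge = Lose" if "truthful w h msg" for msg
  proof (cases msg)
    case (Pair xs f)
    then show ?thesis
      using that time_zero_iff[OF _ 0(1), of xs f] init_cell[OF _ 0(1), of xs f] 0(3,4)
      by (auto simp: judge_def)
  qed
  then show ?case unfolding refuter_wins.simps
    by (intro ballI impI bexI[of _ Challenge]) auto
next
  case (Suc t)
  have "\<exists>y. case judge (Bwd c) msg y of Win \<Rightarrow> False | Lose \<Rightarrow> True | Again \<Rightarrow> False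
      | Next s' \<Rightarrow> refuter_wins (Suc (t + e)) w s' (move_heads w (Bwd c) msg y h)" if tr: "truthful w h msg" for msg
  proof -
    obtain xs f where msg: "msg = (xs, f)" by (cases msg)
    have z: "\<not> all_left xs 0" using time_zero_iff[OF tr[unfolded msg] Suc(2,3)] by simp
    show ?thesis
    proof (cases "next_cell f = c")
      case True
      then have "f \<noteq> (\<lambda>d. cell (conf w t) (move d p))"
        using Suc(5) by (auto simp: conf_Suc cell_step)
      then obtain d where d: "f d \<noteq> cell (conf w t) (move d p)" by blast
      have "refuter_wins (Suc (t + e)) w (Bwd (f d)) (move_heads w (Bwd c) msg (Pick d) h)"
      proof (rule Suc.IH[OF _ _ _ d])
        show "heads_at w (move_heads w (Bwd c) msg (Pick d) h) t (move d p)"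
          unfolding msg by (rule heads_at_move[OF tr[unfolded msg] Suc(2)])
            (simp_all add: time_dir_def cell_dir_def pick_dir_def)
        show "\<bar>move d p\<bar> + int t \<le> 2 * int T" using Suc(4) by (cases d) auto
      qed (use Suc(3) in simp)
      moreover have "judge (Bwd c) msg (Pick d) = Next (Bwd (f d))"
        using z True by (simp add: judge_def msg pick_dir_def)
      ultimately show ?thesis by (intro exI[of _ "Pick d"]) (simp del: refuter_wins.simps)
    next
      case False
      then have "judge (Bwd c) msg Challenge = Lose" using z by (simp add: judge_def msg)
      then show ?thesis by (intro exI[of _ Challenge]) simp
    qed
  qed
  then show ?case unfolding add_Suc refuter_wins.simps(2)[of "Suc (t + e)"]
    by (simp del: refuter_wins.simps)
qed

lemma Fwd_not_halting:
  assumes "conf w t = (q, tape, p)" "t \<le> T" "\<not> halting q"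
  shows "t < T" "conf w (Suc t) = (case tm_delta M q (tape p) of (q', a, d) \<Rightarrow> (q', tape(p := a), move d p))"
proof -
  show "t < T" using assms halted by (metis fst_conv nat_less_le)
  show "conf w (Suc t) = (case tm_delta M q (tape p) of (q', a, d) \<Rightarrow> (q', tape(p := a), move d p))"
    using assms(3) by (simp add: conf_Suc assms(1) halting_def)
qed

text \<open>The index allows for the \<open>T - t\<close> remaining forward steps and for
  \<open>T\<close> further turns, enough for a backward phase started at any time before
  \<open>T\<close>.\<close>

lemma prover_wins_Fwd:
  assumes "conf w t = (q, tape, p)" "t \<le> T" "heads_at w h t p" "fst (conf w T) = tm_accept M"
  shows "prover_wins (Suc (T + (T - t))) w (Fwd q) h"
  using assms(1-3)
proof (induction "T - t" arbitrary: t q tape p h rule: less_induct)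
  case (less t q tape p h)
  let ?f = "\<lambda>_. cell (conf w t) p"
  let ?s = "Fwd q :: 'a cell_claim" and ?msg = "honest w h ?f"
  note msg = honest[OF w less(4), of ?f, OF cell_conf[OF w]]
  have f: "cell (conf w t) p = (tape p, Some q)" by (simp add: less(2) cell_def)
  have "case judge ?s ?msg y of Win \<Rightarrow> True | Lose \<Rightarrow> False | Again \<Rightarrow> True
      | Next s' \<Rightarrow> prover_wins (T + (T - t)) w s' (move_heads w ?s ?msg y h)" for y
  proof (cases "halting q")
    case True
    then have "q = tm_accept M" using conf_halted[of w t T] less(2,3) assms(4) by simp
    then show ?thesis by (simp add: judge_def honest_def)
  next
    case False
    obtain q' a d where \<delta>: "tm_delta M q (tape p) = (q', a, d)" by (cases "tm_delta M q (tape p)") auto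
    have t: "t < T" and c: "conf w (Suc t) = (q', tape(p := a), move d p)"
      using Fwd_not_halting[OF less(2,3) False] \<delta> by auto
    have q: "q \<noteq> tm_accept M" "q \<noteq> tm_reject M" using False by (auto simp: halting_def)
    have p: "\<bar>p\<bar> \<le> int t" using conf_ok[OF w less(2)] by simp
    consider "y = Doubt" | "y = Challenge" | b where "y = Pick b" by (cases y) auto
    then show ?thesis
    proof cases
      case 1
      then show ?thesis by (simp add: judge_def honest_def)
    next
      case 2
      \<comment> \<open>The backward phase from time \<open>t\<close> takes at most
        \<open>t + 1\<close> turns; \<open>e\<close> is the surplus of the index.\<close>
      define e where "e = T + (T - t) - Suc t"
      have e: "T + (T - t) = Suc (t + e)" using t by (simp add: e_def)
      have "prover_wins (Suc (t + e)) w (Bwd (cell (conf w t) p)) (move_heads w ?s ?msg y h)"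
      proof (rule prover_wins_Bwd)
        show "heads_at w (move_heads w ?s ?msg y h) t p"
          unfolding honest_def
          by (rule heads_at_move[OF msg(2)[unfolded honest_def] less(4)]) (simp_all add: 2 time_dir_def cell_dir_def)
      qed (use less(3) p in auto)
      then show ?thesis
        unfolding e using 2 q by (simp add: judge_def honest_def f del: prover_wins.simps)
    next
      case (3 b)
      have next_turn: "prover_wins (Suc (T + (T - Suc t))) w (Fwd q') (move_heads w ?s ?msg y h)"
      proof (rule less(1)[OF _ c])
        show "heads_at w (move_heads w ?s ?msg y h) (Suc t) (move d p)"
          unfolding honest_def
          by (rule heads_at_move[OF msg(2)[unfolded honest_def] less(4)])
            (simp_all add: 3 time_dir_def cell_dir_def f \<delta>)
      qed (use t in auto)
      have fuel: "Suc (T + (T - Suc t)) = T + (T - t)" using t by simp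
      show ?thesis
        using next_turn[unfolded fuel] 3 q by (simp add: judge_def honest_def f \<delta> del: prover_wins.simps)
    qed
  qed
  then show ?case using msg unfolding prover_wins.simps(2)[of "T + (T - t)"]
    by (intro bexI[of _ ?msg] conjI ballI) (simp_all del: prover_wins.simps)
qed

text \<open>Correct announcements are let stand and the first false one is challenged, which yields
  a false claim about the scanned cell. Without a lie the simulation is faithful and reaches the
  rejecting state.\<close>

lemma refuter_wins_Fwd:
  assumes "conf w t = (q, tape, p)" "t \<le> T" "heads_at w h t p" "fst (conf w T) = tm_reject M"
  shows "refuter_wins (Suc (T + (T - t))) w (Fwd q) h"
  using assms(1-3)
proof (induction "T - t" arbitrary: t q tape p h rule: less_induct)
  case (less t q tape p h)
  let ?s = "Fwd q :: 'a cell_claim"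
  have "\<exists>y. case judge ?s msg y of Win \<Rightarrow> False | Lose \<Rightarrow> True | Again \<Rightarrow> False
      | Next s' \<Rightarrow> refuter_wins (T + (T - t)) w s' (move_heads w ?s msg y h)" if tr: "truthful w h msg" for msg
  proof (cases "halting q")
    case True
    then have "q = tm_reject M" using conf_halted[of w t T] less(2,3) assms(4) by simp
    \<comment> \<open>As \<open>judge\<close> tests the accepting state first, the two halting
      states have to be distinct here.\<close>
    then show ?thesis
      using wf_M by (intro exI[of _ Challenge]) (auto simp: judge_def wf_tm_def split: prod.split)
  next
    case False
    obtain xs f where msg: "msg = (xs, f)" by (cases msg)
    obtain q' a d where \<delta>: "tm_delta M q (tape p) = (q', a, d)" by (cases "tm_delta M q (tape p)") auto
    have t: "t < T" and c: "conf w (Suc t) = (q', tape(p := a), move d p)"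
      using Fwd_not_halting[OF less(2,3) False] \<delta> by auto
    have q: "q \<noteq> tm_accept M" "q \<noteq> tm_reject M" using False by (auto simp: halting_def)
    have p: "\<bar>p\<bar> \<le> int t" using conf_ok[OF w less(2)] by simp
    show ?thesis
    proof (cases "fst (f Stay) = tape p")
      case True
      have next_turn: "refuter_wins (Suc (T + (T - Suc t))) w (Fwd q') (move_heads w ?s msg (Pick Stay) h)"
      proof (rule less(1)[OF _ c])
        show "heads_at w (move_heads w ?s msg (Pick Stay) h) (Suc t) (move d p)"
          unfolding msg by (rule heads_at_move[OF tr[unfolded msg] less(4)])
            (simp_all add: time_dir_def cell_dir_def True \<delta>)
      qed (use t in auto)
      have fuel: "Suc (T + (T - Suc t)) = T + (T - t)" using t by simp
      show ?thesis
        using next_turn[unfolded fuel] q by (intro exI[of _ "Pick Stay"]) (simp add: judge_def msg True \<delta> del: refuter_wins.simps)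
    next
      case lie: False
      define e where "e = T + (T - t) - Suc t"
      have e: "T + (T - t) = Suc (t + e)" using t by (simp add: e_def)
      have "refuter_wins (Suc (t + e)) w (Bwd (fst (f Stay), Some q)) (move_heads w ?s msg Challenge h)"
      proof (rule refuter_wins_Bwd)
        show "heads_at w (move_heads w ?s msg Challenge h) t p"
          unfolding msg by (rule heads_at_move[OF tr[unfolded msg] less(4)])
            (simp_all add: time_dir_def cell_dir_def)
      qed (use less(2,3) p lie in \<open>auto simp: cell_def\<close>)
      then show ?thesis
        unfolding e using q by (intro exI[of _ Challenge]) (simp add: judge_def msg del: refuter_wins.simps)
    qed
  qed
  then show ?case unfolding refuter_wins.simps(2)[of "T + (T - t)"]
    by (simp del: refuter_wins.simps)
qed

lemma game_value:
  "fst (conf w T) = tm_accept M \<Longrightarrow> \<exists>k. prover_wins k w (Fwd (tm_start M)) initial_heads"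
  "fst (conf w T) = tm_reject M \<Longrightarrow> \<exists>k. refuter_wins k w (Fwd (tm_start M)) initial_heads"
proof -
  have c: "conf w 0 = (tm_start M, fst (snd (conf w 0)), 0)" by (simp add: conf_def tm_init_def)
  show "fst (conf w T) = tm_accept M \<Longrightarrow> \<exists>k. prover_wins k w (Fwd (tm_start M)) initial_heads"
    using prover_wins_Fwd[OF c _ heads_at_initial] by blast
  show "fst (conf w T) = tm_reject M \<Longrightarrow> \<exists>k. refuter_wins k w (Fwd (tm_start M)) initial_heads"
    using refuter_wins_Fwd[OF c _ heads_at_initial] by blast
qed

end

end

section \<open>Choice of the constants and the inclusion of \<open>class_P\<close>\<close>

theorem theorem7:
  fixes \<Sigma> :: "'a set"
  assumes "finite \<Sigma>" and "\<Sigma> \<noteq> {}"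
  shows "class_P \<Sigma> \<subseteq> pc_strong_low_CDEB_con_inf_con \<Sigma>"
proof
  fix L assume "L \<in> class_P \<Sigma>"
  then obtain M :: "'a tm" and p :: "nat poly" where L: "L \<subseteq> lists \<Sigma>" and M: "wf_tm \<Sigma> M"
    and dec: "\<And>w. w \<in> lists \<Sigma> \<Longrightarrow> \<exists>t \<le> poly p (length w).
      fst ((tm_step M ^^ t) (tm_init M w)) = (if w \<in> L then tm_accept M else tm_reject M)"
    unfolding class_P_def by blast
  \<comment> \<open>At \<open>n = length w\<close> the polynomial has the value
    \<open>2 * poly p n + n + 3\<close>, which yields the bound \<open>big\<close> for every
    \<open>T\<close> within the time bound.\<close>
  obtain m where m: "\<And>n. poly (2 * p + [:3, 1:]) n < (n + 2) ^ m"
    using poly_less_power by blast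
  have m_pos: "m > 0" using m[of 0] by (cases m) auto
  show "L \<in> pc_strong_low_CDEB_con_inf_con \<Sigma>"
    unfolding pc_strong_low_CDEB_con_inf_con_def mem_Collect_eq
  proof (intro conjI allI impI)
    show "L \<subseteq> lists \<Sigma>" by (rule L)
    fix \<epsilon> :: real assume "\<epsilon> > 0"
    \<comment> \<open>A bound on the probability that the \<open>3 * m\<close> coins of one round
      miss a given head. The number of rounds is taken as \<open>Suc N\<close> because it has to be
      positive, while \<open>N\<close> may be \<open>0\<close> for large
      \<open>\<epsilon>\<close>.\<close>
    define x :: real where "x = 1 - 1 / 2 ^ (3 * m)"
    have x: "0 \<le> x" "x < 1" by (simp_all add: x_def)
    obtain N where "x ^ N < \<epsilon>" using real_arch_pow_inv[OF \<open>\<epsilon> > 0\<close> x(2)] by blast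
    then have N: "x ^ Suc N \<le> \<epsilon>" using power_Suc_le_self[of x N] mult_left_le_one_le[of "x ^ N" x] x by simp
    interpret tm_protocol \<Sigma> M m "Suc N"
      by unfold_locales (use assms M m_pos in auto)
    have game: "(w \<in> L \<longrightarrow> (\<exists>k. prover_wins k w (Fwd (tm_start M)) initial_heads)) \<and>
        (w \<notin> L \<longrightarrow> (\<exists>k. refuter_wins k w (Fwd (tm_start M)) initial_heads))" if w: "w \<in> lists \<Sigma>" for w
    proof -
      obtain T where T: "T \<le> poly p (length w)"
        "fst (conf w T) = (if w \<in> L then tm_accept M else tm_reject M)"
        using dec[OF w] unfolding conf_def by blast
      have "2 * T + length w + 3 \<le> (length w + 2) ^ m" using m[of "length w"] T(1) by simp
      then have "int (2 * T + length w + 3) \<le> int ((length w + 2) ^ m)" by (rule of_nat_mono)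
      then have "2 * int T + int (length w) + 3 \<le> (int (length w) + 2) ^ m" by (simp add: add.commute[of "2::int"])
      moreover have "halting (fst (conf w T))" unfolding T(2) by (simp add: halting_def)
      ultimately show ?thesis
        using game_value[OF w] T(2) by auto
    qed
    have "\<forall>P\<in>prover_strategies \<Sigma> V. \<exists>R\<in>refuter_strategies \<Sigma> V. 1 - \<epsilon> \<le> rej_prob V P R w"
      if "w \<in> lists \<Sigma> - L" for w
    proof -
      have "\<forall>P\<in>prover_strategies \<Sigma> V. \<exists>R\<in>refuter_strategies \<Sigma> V. 1 - x ^ Suc N \<le> rej_prob V P R w"
        unfolding x_def using soundness[of w] game[of w] that by blast
      moreover have "1 - \<epsilon> \<le> 1 - x ^ Suc N" using N by simp
      ultimately show ?thesis by (meson order_trans)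
    qed
    moreover have "\<exists>P\<in>prover_strategies \<Sigma> V. \<forall>R\<in>refuter_strategies \<Sigma> V. acc_prob V P R w = 1"
      if "w \<in> L" for w
      using completeness[of w] game[of w] that L by blast
    ultimately show "\<exists>(V :: 'a verifier) c. wf_verifier \<Sigma> V \<and> tosses_at_most \<Sigma> V c \<and>
      (\<forall>w \<in> L. \<exists>P \<in> prover_strategies \<Sigma> V. \<forall>R \<in> refuter_strategies \<Sigma> V. acc_prob V P R w = 1) \<and>
      (\<forall>w \<in> lists \<Sigma> - L. \<forall>P \<in> prover_strategies \<Sigma> V. \<exists>R \<in> refuter_strategies \<Sigma> V.
        rej_prob V P R w \<ge> 1 - \<epsilon>)"
      using wf_V tosses_at_most_V by blast
  qed
qed

end
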